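(* Let $r\ge 2$ and $k$ be integers with $2\le k\le r$, let $\omega=\omega(n)\to\infty$ as $n\to\infty$, and let $p=p(n)=\omega\frac{\log n}{n^{r-1}}\in[0,1]$. Let $H\in H_r(n,p)$. Then there is a constant $C>0$ such that, with probability tending to $1$ as $n\to\infty$, $$\mathcal{AC}^k_r(H)\le C\max\left\{\frac{\log n}{p\,n^{r-k}},\,1\right\}.$$
   Context: $H_r(n,p)$ is the random $r$-uniform hypergraph on vertex set $[n]$ in which every $r$-element subset of $[n]$ is an edge independently with probability $p$. For an $r$-uniform hypergraph $H=(V,E)$, the $k$-acquaintance time $\mathcal{AC}^k_r(H)$ is defined as follows. One agent is placed on each vertex. In each round one chooses a matching $M$ of pairs of vertices, where each pair $\{u,v\}\in M$ must be contained in some edge of $H$, and swaps the agents on the endpoints of each pair of $M$. A set of $k$ agents becomes $k$-acquainted (and remains so) once, at some time (including the start), the vertices they occupy are all contained in a common edge of $H$. $\mathcal{AC}^k_r(H)$ is the minimum number of rounds needed until every $k$-element set of agents is $k$-acquainted. $\log$ is the natural logarithm. *)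

theory Defs
  imports "HOL-Probability.Probability" "HOL-Probability.Product_PMF"
begin

definition uniform_edges :: "nat \<Rightarrow> nat \<Rightarrow> nat set set" where
  "uniform_edges r n = {e. e \<subseteq> {1..n} \<and> card e = r}"

text \<open>
  A hypergraph on a known vertex set is represented by its set of edges. The random hypergraph
  arises from one independent biased coin per \<open>r\<close>-subset of \<open>{1..n}\<close>.
\<close>

definition random_hypergraph :: "nat \<Rightarrow> nat \<Rightarrow> real \<Rightarrow> nat set set pmf" where
  "random_hypergraph r n p =
     map_pmf (\<lambda>coin. {e \<in> uniform_edges r n. coin e})
       (Pi_pmf (uniform_edges r n) False (\<lambda>_. bernoulli_pmf p))"

definition swap_matching :: "'a set set \<Rightarrow> 'a set set \<Rightarrow> bool" where
  "swap_matching E M \<longleftrightarrow>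
     (\<forall>m\<in>M. card m = 2 \<and> (\<exists>e\<in>E. m \<subseteq> e)) \<and> pairwise disjnt M"

definition swap_along :: "'a set set \<Rightarrow> 'a \<Rightarrow> 'a" where
  "swap_along M v =
     (if \<exists>u. u \<noteq> v \<and> {u, v} \<in> M then THE u. u \<noteq> v \<and> {u, v} \<in> M else v)"

text \<open>
  Agents are named by their initial vertices. After the rounds \<open>Ms\<close> (first round at the head),
  agent \<open>a\<close> occupies the vertex \<open>agent_position Ms a\<close>.
\<close>

definition agent_position :: "'a set set list \<Rightarrow> 'a \<Rightarrow> 'a" where
  "agent_position Ms a = fold swap_along Ms a"

definition acquainted :: "'a set set \<Rightarrow> 'a set set list \<Rightarrow> 'a set \<Rightarrow> bool" where
  "acquainted E Ms A \<longleftrightarrow>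
     (\<exists>t\<le>length Ms. \<exists>e\<in>E. agent_position (take t Ms) ` A \<subseteq> e)"

definition acquaintance_strategy :: "nat \<Rightarrow> 'a set \<Rightarrow> 'a set set \<Rightarrow> 'a set set list \<Rightarrow> bool" where
  "acquaintance_strategy k V E Ms \<longleftrightarrow>
     (\<forall>M\<in>set Ms. swap_matching E M) \<and>
     (\<forall>A. A \<subseteq> V \<and> card A = k \<longrightarrow> acquainted E Ms A)"

text \<open>The value is \<open>\<infinity>\<close> if no finite number of rounds acquaints all \<open>k\<close>-sets of agents.\<close>

definition acquaintance_time :: "nat \<Rightarrow> 'a set \<Rightarrow> 'a set set \<Rightarrow> enat" where
  "acquaintance_time k V E = (INF Ms \<in> {Ms. acquaintance_strategy k V E Ms}. enat (length Ms))"

end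

theory Submission
  imports Defs "HOL-Combinatorics.Permutations"
begin

text \<open>
  Expose the random hypergraph in three independent rounds of density at least \<open>p / 3\<close> each. The
  first round has an edge between any two disjoint sets of linear size, so depth-first search finds
  a path through all but a small fraction of the vertices. By Hall's theorem the second round
  supplies \<open>k\<close> disjoint matchings of the remaining vertices into the path, and by swapping along
  them every \<open>k\<close>-set of agents can be brought onto the path.

  Swapping alternately along the even and the odd edges of a path of \<open>N\<close> vertices rotates its
  occupants cyclically with period \<open>N\<close>, and a path can realise any permutation in \<open>O(N)\<close> rounds by
  odd-even transposition sort. A partial rotation, or full rotations started from greedily chosen
  permutations, lets every \<open>k\<close>-set of agents occupy \<open>L\<close> different \<open>k\<close>-sets of vertices within
  \<open>O(L)\<close> rounds. For \<open>L\<close> of order \<open>log n / (p n^(r-k))\<close> the probability that no edge of the third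
  round contains one of them is so small that the union bound over all \<open>k\<close>-sets applies.
\<close>

section \<open>Rotating the occupants of a path\<close>

text \<open>What counts is the number of different \<open>k\<close>-sets of vertices that a set of
  agents occupies: \<open>L\<close> of them lie in at least order \<open>L n^(r-k)\<close> possible
  edges, and all of these are absent with probability about
  \<open>exp (- const p L n^(r-k))\<close>. This beats the at most \<open>n^k\<close> sets of agents
  once \<open>L\<close> is a large multiple of \<open>log n / (p n^(r-k))\<close>. The schedule must
  be fixed before the deciding edges are revealed, hence the separate exposures. The obstacle is
  that a rotation yields at most \<open>N\<close> sets, while for \<open>k \<ge> 3\<close> the
  required \<open>L\<close> may be far larger, up to order \<open>n^(k-1) / \<omega>\<close>. Full
  rotations from several starting permutations are then needed, and a single choice of them has to
  avoid repeated orbits for all \<open>k\<close>-sets of agents at once. Since \<open>L\<close>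
  stays below order \<open>n^(k-1)\<close> while there are order \<open>n^k\<close> sets of
  positions, a random permutation rarely meets an earlier orbit, and an exponential potential
  handles all agent sets together.\<close>

definition gates :: "nat \<Rightarrow> nat set \<Rightarrow> bool" where
  "gates N I \<longleftrightarrow> (\<forall>i\<in>I. Suc i < N \<and> Suc i \<notin> I)"

text \<open>An index \<open>i\<close> in \<open>I\<close> stands for the path edge from
  \<open>i\<close> to \<open>Suc i\<close>; under \<open>gates\<close> these edges form a matching,
  and this is the permutation of positions caused by swapping along it.\<close>

definition gate_swap :: "nat set \<Rightarrow> nat \<Rightarrow> nat" where
  "gate_swap I x = (if x \<in> I then Suc x else if 0 < x \<and> x - 1 \<in> I then x - 1 else x)"

lemma gate_swap_less: "gates N I \<Longrightarrow> x < N \<Longrightarrow> gate_swap I x < N"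
  by (auto simp: gates_def gate_swap_def)

lemma gate_swap_involution: "gates N I \<Longrightarrow> gate_swap I (gate_swap I x) = x"
  by (cases x) (auto simp: gates_def gate_swap_def)

lemma fold_gate_swap_less:
  "\<forall>I\<in>set Is. gates N I \<Longrightarrow> x < N \<Longrightarrow> fold gate_swap Is x < N"
  by (induction Is arbitrary: x) (auto simp: gate_swap_less)

lemma inj_fold_gate_swap:
  "\<forall>I\<in>set Is. gates N I \<Longrightarrow> inj (fold gate_swap Is)"
proof (induction Is)
  case (Cons I Is)
  have "inj (gate_swap I)"
    using Cons.prems by (intro inj_on_inverseI[of _ "gate_swap I"]) (auto simp: gate_swap_involution)
  then show ?case
    using Cons inj_compose[of "fold gate_swap Is" "gate_swap I"] by (simp add: comp_def)
qed auto

definition even_gates :: "nat \<Rightarrow> nat set" where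
  "even_gates N = {i. even i \<and> Suc i < N}"

definition odd_gates :: "nat \<Rightarrow> nat set" where
  "odd_gates N = {i. odd i \<and> Suc i < N}"

lemma gates_even_odd: "gates N (even_gates N)" "gates N (odd_gates N)"
  by (auto simp: gates_def even_gates_def odd_gates_def)

text \<open>
  One even round followed by one odd round moves the occupants of even positions two steps to the
  right and those of odd positions two steps to the left, turning around at the ends. This is the
  cyclic shift once the positions are renumbered \<open>0, 2, 4, \<dots>, 5, 3, 1\<close>.
\<close>

definition cyclic_index :: "nat \<Rightarrow> nat \<Rightarrow> nat" where
  "cyclic_index N x = (if even x then x div 2 else N - Suc (x div 2))"

lemma cyclic_index_less: "x < N \<Longrightarrow> cyclic_index N x < N"
  by (auto simp: cyclic_index_def)

lemma inj_on_cyclic_index: "inj_on (cyclic_index N) {..<N}"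
proof (rule inj_onI)
  fix x y assume xy: "x \<in> {..<N}" "y \<in> {..<N}" "cyclic_index N x = cyclic_index N y"
  consider a b where "x = 2 * a" "y = 2 * b" | a b where "x = 2 * a" "y = 2 * b + 1"
    | a b where "x = 2 * a + 1" "y = 2 * b" | a b where "x = 2 * a + 1" "y = 2 * b + 1"
    by (metis evenE oddE)
  then show "x = y"
    by cases (use xy in \<open>auto simp: cyclic_index_def\<close>)
qed

lemma cyclic_index_rotate:
  assumes "x < N"
  shows "cyclic_index N (gate_swap (odd_gates N) (gate_swap (even_gates N) x)) = Suc (cyclic_index N x) mod N"
proof (cases "even x")
  case True
  then obtain a where x: "x = 2 * a" by (auto elim: evenE)
  \<comment> \<open>Generic even positions move two places to the right; the other two cases are the
    right end, where the occupant turns around, for even and odd \<open>N\<close>.\<close>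
  consider "2 * a + 2 < N" | "2 * a + 2 = N" | "2 * a + 1 = N"
    using assms x by linarith
  then show ?thesis
  proof cases
    case 3
    then show ?thesis using x
      by (cases a) (auto simp: gate_swap_def even_gates_def odd_gates_def cyclic_index_def)
  qed (use x in \<open>auto simp: gate_swap_def even_gates_def odd_gates_def cyclic_index_def\<close>)
next
  case False
  then obtain a where x: "x = 2 * a + 1" by (auto elim: oddE)
  show ?thesis
  proof (cases "a = 0")
    \<comment> \<open>Position 1 comes last in the cyclic order: its occupant moves to position 0,
      where the index wraps around.\<close>
    case True
    then show ?thesis using x assms
      by (auto simp: gate_swap_def even_gates_def odd_gates_def cyclic_index_def)
  next
    case False
    then have "even (2 * a)" "odd (2 * a - 1)" "(2 * a - 1) div 2 = a - 1"
      by auto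
    then show ?thesis using x assms False
      by (auto simp: gate_swap_def even_gates_def odd_gates_def cyclic_index_def)
  qed
qed

definition rotation :: "nat \<Rightarrow> nat \<Rightarrow> nat set list" where
  "rotation N l = concat (replicate l [even_gates N, odd_gates N])"

abbreviation rotate_by :: "nat \<Rightarrow> nat \<Rightarrow> nat \<Rightarrow> nat" where
  "rotate_by N l \<equiv> fold gate_swap (rotation N l)"

lemma length_rotation: "length (rotation N l) = 2 * l"
  by (induction l) (auto simp: rotation_def)

lemma gates_rotation: "\<forall>I\<in>set (rotation N l). gates N I"
  by (auto simp: rotation_def gates_even_odd)

lemma rotation_add: "rotation N (l + l') = rotation N l @ rotation N l'"
  by (simp add: rotation_def replicate_add)

lemma take_rotation: "l \<le> s \<Longrightarrow> take (2 * l) (rotation N s) = rotation N l"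
  using rotation_add[of N l "s - l"] by (simp add: length_rotation)

lemma cyclic_index_rotate_by:
  "x < N \<Longrightarrow> cyclic_index N (rotate_by N l x) = (cyclic_index N x + l) mod N"
proof (induction l)
  case 0
  then show ?case by (simp add: rotation_def cyclic_index_less)
next
  case (Suc l)
  have "rotate_by N (Suc l) x = gate_swap (odd_gates N) (gate_swap (even_gates N) (rotate_by N l x))"
    using rotation_add[of N l 1] by (simp add: rotation_def)
  moreover have "rotate_by N l x < N"
    using Suc.prems gates_rotation by (intro fold_gate_swap_less) auto
  ultimately show ?case
    using Suc by (simp add: cyclic_index_rotate mod_Suc_eq)
qed

lemma rotate_by_eqI:
  assumes "x < N" "y < N" "(cyclic_index N x + l) mod N = (cyclic_index N y + l') mod N"
  shows "rotate_by N l x = rotate_by N l' y"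
proof (rule inj_onD[OF inj_on_cyclic_index[of N]])
  show "cyclic_index N (rotate_by N l x) = cyclic_index N (rotate_by N l' y)"
    using assms by (simp add: cyclic_index_rotate_by)
qed (use assms fold_gate_swap_less[OF gates_rotation] in auto)

text \<open>Only the times after complete even-odd pairs are recorded, because there the motion is a
  translation modulo \<open>N\<close>. For \<open>s = N\<close> this is the orbit of
  \<open>B\<close> under a cyclic group.\<close>

definition rotation_orbit :: "nat \<Rightarrow> nat \<Rightarrow> nat set \<Rightarrow> nat set set" where
  "rotation_orbit N s B = (\<lambda>l. rotate_by N l ` B) ` {..<s}"

lemma card_rotation_orbit_le: "card (rotation_orbit N s B) \<le> s"
  unfolding rotation_orbit_def using card_image_le[of "{..<s}"] by auto

lemma finite_rotation_orbit: "finite (rotation_orbit N s B)"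
  by (auto simp: rotation_orbit_def)

lemma inj_rotate_by: "inj (rotate_by N l)"
  by (rule inj_fold_gate_swap[OF gates_rotation])

lemma rotation_orbit_ksubset:
  assumes "C \<in> rotation_orbit N s B" "B \<subseteq> {..<N}"
  shows "C \<subseteq> {..<N} \<and> card C = card B"
proof -
  obtain l where C: "C = rotate_by N l ` B"
    using assms(1) by (auto simp: rotation_orbit_def)
  have "card C = card B"
    unfolding C by (intro card_image inj_on_subset[OF inj_rotate_by]) auto
  moreover have "C \<subseteq> {..<N}"
    unfolding C using assms(2) fold_gate_swap_less[OF gates_rotation] by auto
  ultimately show ?thesis by simp
qed

text \<open>A point \<open>b\<close> of \<open>B\<close> visits \<open>s\<close> different places, at most \<open>card B\<close> of them inside each image of \<open>B\<close>.\<close>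

lemma card_rotation_orbit_ge:
  assumes "B \<subseteq> {..<N}" "B \<noteq> {}" "s \<le> N"
  shows "s \<le> card B * card (rotation_orbit N s B)"
proof -
  obtain b where b: "b \<in> B" "b < N" using assms by auto
  have inj: "inj_on (\<lambda>l. rotate_by N l b) {..<s}"
  proof (rule inj_onI)
    fix l l' assume l: "l \<in> {..<s}" "l' \<in> {..<s}" "rotate_by N l b = rotate_by N l' b"
    then have "(cyclic_index N b + l) mod N = (cyclic_index N b + l') mod N"
      using cyclic_index_rotate_by b by metis
    moreover have "cyclic_index N b < N" "l < N" "l' < N"
      using l assms b by (auto simp: cyclic_index_less)
    ultimately show "l = l'"
      by (auto simp: mod_if split: if_splits)
  qed
  let ?S = "SIGMA C:rotation_orbit N s B. C"
  have fin: "finite C" if "C \<in> rotation_orbit N s B" for C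
    using rotation_orbit_ksubset[OF that assms(1)] finite_subset by blast
  have "s = card {..<s}" by simp
  also have "\<dots> \<le> card ?S"
  proof (rule card_inj_on_le)
    show "inj_on (\<lambda>l. (rotate_by N l ` B, rotate_by N l b)) {..<s}"
      using inj by (auto simp: inj_on_def)
    show "(\<lambda>l. (rotate_by N l ` B, rotate_by N l b)) ` {..<s} \<subseteq> ?S"
      using b by (auto simp: rotation_orbit_def)
    show "finite ?S"
      using fin finite_rotation_orbit by auto
  qed
  also have "\<dots> = (\<Sum>C\<in>rotation_orbit N s B. card C)"
    using fin finite_rotation_orbit by (subst card_SigmaI) auto
  also have "\<dots> = (\<Sum>C\<in>rotation_orbit N s B. card B)"
    using rotation_orbit_ksubset[OF _ assms(1)] by (intro sum.cong) auto
  finally show ?thesis by (simp add: mult.commute)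
qed

text \<open>A common member makes \<open>B\<close> a translate of \<open>B'\<close>. Undoing
  \<open>l\<close> steps means going \<open>N - l\<close> steps further, since \<open>N\<close>
  steps are the identity.\<close>

lemma rotation_orbit_disjoint:
  assumes "B \<subseteq> {..<N}" "B' \<subseteq> {..<N}" "B \<notin> rotation_orbit N N B'"
  shows "rotation_orbit N N B \<inter> rotation_orbit N N B' = {}"
proof (rule ccontr)
  assume "\<not> ?thesis"
  then obtain l l' where l: "l < N" "l' < N" and eq: "rotate_by N l ` B = rotate_by N l' ` B'"
    by (auto simp: rotation_orbit_def)
  have undo: "rotate_by N (N - l) (rotate_by N l x) = x" if "x < N" for x
  proof -
    have "rotate_by N (N - l) (rotate_by N l x) = rotate_by N N x"
      using rotation_add[of N l "N - l"] l by simp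
    also have "\<dots> = rotate_by N 0 x"
      using that by (intro rotate_by_eqI) auto
    finally show ?thesis by (simp add: rotation_def)
  qed
  have "rotate_by N (N - l) ` rotate_by N l ` B = B"
    using undo assms(1) by (force simp: image_iff)
  then have "B = rotate_by N (N - l) ` rotate_by N l' ` B'"
    using eq by simp
  also have "\<dots> = rotate_by N (l' + (N - l)) ` B'"
    by (simp add: rotation_add image_image)
  also have "\<dots> = rotate_by N ((l' + (N - l)) mod N) ` B'"
    using assms(2) by (intro image_cong refl rotate_by_eqI) (auto simp: mod_add_right_eq)
  finally have "B \<in> rotation_orbit N N B'"
    unfolding rotation_orbit_def using l by (intro image_eqI[where x="(l' + (N - l)) mod N"]) auto
  then show False using assms(3) by simp
qed

section \<open>Odd-even transposition sort on a path\<close>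

text \<open>The value \<open>w x\<close> is the destination of the agent currently at
  \<open>x\<close>.\<close>

definition sort_gates :: "nat \<Rightarrow> (nat \<Rightarrow> nat) \<Rightarrow> nat \<Rightarrow> nat set" where
  "sort_gates N w t = {x. Suc x < N \<and> x mod 2 = t mod 2 \<and> w (Suc x) < w x}"

lemma gates_sort_gates: "gates N (sort_gates N w t)"
  by (auto simp: gates_def sort_gates_def mod_Suc split: if_splits)

text \<open>The 0-1 principle in counting form: each key is replaced by the bit
  \<open>\<theta> \<le> w y\<close>, and the number of ones from \<open>x\<close> on is
  followed.\<close>

definition tail_count :: "nat \<Rightarrow> (nat \<Rightarrow> nat) \<Rightarrow> nat \<Rightarrow> nat \<Rightarrow> nat" where
  "tail_count N w \<theta> x = card {y. x \<le> y \<and> y < N \<and> \<theta> \<le> w y}"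

lemma tail_count_step:
  assumes "x < N"
  shows "tail_count N w \<theta> x = tail_count N w \<theta> (Suc x) + (if \<theta> \<le> w x then 1 else 0)"
proof -
  have fin: "finite {y. Suc x \<le> y \<and> y < N \<and> \<theta> \<le> w y}"
    by (rule finite_subset[of _ "{..<N}"]) auto
  have "{y. x \<le> y \<and> y < N \<and> \<theta> \<le> w y} =
      (if \<theta> \<le> w x then insert x {y. Suc x \<le> y \<and> y < N \<and> \<theta> \<le> w y} else {y. Suc x \<le> y \<and> y < N \<and> \<theta> \<le> w y})"
    using assms by (auto simp: le_Suc_eq Suc_le_eq order_le_less)
  then show ?thesis
    using fin by (simp add: tail_count_def)
qed

text \<open>No gate crosses the cut just before \<open>x\<close>, so the swaps permute the positions
  from \<open>x\<close> on among themselves.\<close>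

lemma tail_count_eq_if:
  assumes "gates N I" "x = 0 \<or> x - 1 \<notin> I"
  shows "tail_count N (w \<circ> gate_swap I) \<theta> x = tail_count N w \<theta> x"
proof -
  have ge: "x \<le> gate_swap I y" if "x \<le> y" for y
    using that assms by (cases "y = x") (auto simp: gate_swap_def gates_def)
  have "bij_betw (gate_swap I) {y. x \<le> y \<and> y < N \<and> \<theta> \<le> (w \<circ> gate_swap I) y} {y. x \<le> y \<and> y < N \<and> \<theta> \<le> w y}"
    by (rule bij_betwI[of _ _ _ "gate_swap I"])
       (use assms(1) ge in \<open>auto simp: gate_swap_less gate_swap_involution\<close>)
  then show ?thesis
    unfolding tail_count_def by (rule bij_betw_same_card)
qed

text \<open>The counts from \<open>x\<close> and from \<open>x + 2\<close> do not change, and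
  afterwards the larger of the two compared keys is at \<open>x + 1\<close>. So either the bit there
  is one, or both bits are zero and the counts from \<open>x\<close> and \<open>x + 1\<close>
  agree.\<close>

lemma tail_count_sort_step:
  fixes w :: "nat \<Rightarrow> nat"
  assumes "Suc x < N" "x mod 2 = t mod 2"
  defines "w' \<equiv> w \<circ> gate_swap (sort_gates N w t)"
  shows "min (tail_count N w \<theta> x) (Suc (tail_count N w \<theta> (Suc (Suc x)))) \<le> tail_count N w' \<theta> (Suc x)"
proof -
  let ?I = "sort_gates N w t"
  have par: "Suc x \<notin> ?I" "x = 0 \<or> x - 1 \<notin> ?I"
    using assms(2) unfolding sort_gates_def by (cases x; auto simp: mod_Suc split: if_splits)+
  have eq: "tail_count N w' \<theta> x = tail_count N w \<theta> x"
    "tail_count N w' \<theta> (Suc (Suc x)) = tail_count N w \<theta> (Suc (Suc x))"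
    unfolding w'_def using par by (auto intro!: tail_count_eq_if gates_sort_gates)
  have "w' x \<le> w' (Suc x)"
    using assms(1,2) par by (auto simp: w'_def gate_swap_def sort_gates_def)
  then show ?thesis
    using eq tail_count_step[of x N w' \<theta>] tail_count_step[of "Suc x" N w' \<theta>] assms(1)
    by (auto split: if_splits)
qed

fun sort_state :: "nat \<Rightarrow> (nat \<Rightarrow> nat) \<Rightarrow> nat \<Rightarrow> nat \<Rightarrow> nat" where
  "sort_state N w 0 = w"
| "sort_state N w (Suc t) = sort_state N w t \<circ> gate_swap (sort_gates N (sort_state N w t) t)"

definition sort_rounds :: "nat \<Rightarrow> (nat \<Rightarrow> nat) \<Rightarrow> nat \<Rightarrow> nat set list" where
  "sort_rounds N w T = map (\<lambda>t. sort_gates N (sort_state N w t) t) [0..<T]"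

lemma sort_state_bij: "bij_betw w {..<N} {..<N} \<Longrightarrow> bij_betw (sort_state N w t) {..<N} {..<N}"
proof (induction t)
  case (Suc t)
  have "bij_betw (gate_swap (sort_gates N (sort_state N w t) t)) {..<N} {..<N}"
    by (rule bij_betwI[of _ _ _ "gate_swap (sort_gates N (sort_state N w t) t)"])
       (auto simp: gate_swap_less[OF gates_sort_gates] gate_swap_involution[OF gates_sort_gates])
  then show ?case
    using Suc bij_betw_trans unfolding sort_state.simps by blast
qed auto

text \<open>Every agent carries its key along; once the state is the identity, the position of an
  agent is its key, that is, its destination.\<close>

lemma sort_state_fold: "sort_state N w T (fold gate_swap (sort_rounds N w T) a) = w a"
  by (induction T arbitrary: a) (auto simp: sort_rounds_def gate_swap_involution[OF gates_sort_gates])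

text \<open>
  On the points \<open>x\<close> of the same parity as \<open>t\<close>, the bound \<open>(t - x) / 2\<close> is an exact solution of the
  recursion \<open>h (t+1) x = min (h t (x-1)) (h t (x+1) + 1)\<close>; the other points lag one round behind.
\<close>

lemma tail_count_sort_state:
  fixes N w \<theta>
  defines "h \<equiv> \<lambda>t x. tail_count N (sort_state N w t) \<theta> x"
  shows "x \<le> N \<Longrightarrow> h 0 0 \<le> h t x \<or> N - x \<le> h t x \<or>
    int t - int x - (if x mod 2 = t mod 2 then 0 else 1) \<le> 2 * int (h t x)"
proof (induction t arbitrary: x)
  case 0
  then show ?case by simp
next
  case (Suc t)
  show ?case
  \<comment> \<open>The gates of round \<open>t\<close> start at positions of the parity of
    \<open>t\<close>, so a gate can cross the cut before \<open>x\<close> only in the remaining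
    case.\<close>
  proof (cases "x = 0 \<or> x = N \<or> x mod 2 = t mod 2")
    case True
    consider "x = 0" | "x = N" | "x mod 2 = t mod 2" using True by blast
    then show ?thesis
    proof cases
      case 1
      have "h (Suc t) 0 = h t 0" for t
        unfolding h_def sort_state.simps by (rule tail_count_eq_if[OF gates_sort_gates]) simp
      then have "h t 0 = h 0 0" for t
        by (induction t) auto
      from this[of "Suc t"] show ?thesis using 1 by simp
    next
      case 2
      then show ?thesis by simp
    next
      case 3
      have "x = 0 \<or> x - 1 \<notin> sort_gates N (sort_state N w t) t"
        using 3 unfolding sort_gates_def by (cases x) (auto simp: mod_Suc split: if_splits)
      then have "h (Suc t) x = h t x"
        unfolding h_def sort_state.simps by (rule tail_count_eq_if[OF gates_sort_gates])
      then show ?thesis using Suc.IH[OF Suc.prems] 3 by (auto simp: mod_Suc split: if_splits)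
    qed
  next
    case False
    then obtain x' where x': "x = Suc x'" "Suc x' < N" "x' mod 2 = t mod 2"
      using Suc.prems by (cases x) (auto simp: mod_Suc split: if_splits)
    have "min (h t x') (Suc (h t (Suc (Suc x')))) \<le> h (Suc t) x"
      using tail_count_sort_step[OF x'(2,3)] x'(1) by (auto simp: h_def)
    moreover have "Suc (Suc x') mod 2 = t mod 2" "x mod 2 = Suc t mod 2"
      using x' by (auto simp: mod_Suc)
    moreover have "h 0 0 \<le> h t x' \<or> N - x' \<le> h t x' \<or> int t - int x' \<le> 2 * int (h t x')"
      using Suc.IH[of x'] x' by simp
    moreover have "h 0 0 \<le> h t (Suc (Suc x')) \<or> N - Suc (Suc x') \<le> h t (Suc (Suc x')) \<or>
        int t - int (Suc (Suc x')) \<le> 2 * int (h t (Suc (Suc x')))"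
      using Suc.IH[of "Suc (Suc x')"] x' calculation(2) by simp
    ultimately have "h 0 0 \<le> h (Suc t) x \<or> N - x \<le> h (Suc t) x \<or> int (Suc t) - int x \<le> 2 * int (h (Suc t) x)"
      using x'(1,2) by linarith
    then show ?thesis
      using \<open>x mod 2 = Suc t mod 2\<close> by simp
  qed
qed

lemma sort_state_sorted:
  assumes "bij_betw w {..<N} {..<N}" "x < N"
  shows "sort_state N w (3 * N + 1) x = x"
proof -
  \<comment> \<open>After this many rounds, twice the tail count is at least
    \<open>3 * N - y \<ge> 2 * (N - y)\<close> unless another alternative already gives
    \<open>N - y\<close>; so from \<open>y\<close> on all keys are at least
    \<open>y\<close>.\<close>
  define T where "T = 3 * N + 1"
  define v where "v = sort_state N w T"
  have ge: "y \<le> v y" if y: "y < N" for y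
  proof -
    have "card {y'. 0 \<le> y' \<and> y' < N \<and> y \<le> w y'} = N - y"
    proof -
      have img: "w ` {..<N} = {..<N}" and inj: "inj_on w {..<N}"
        using assms(1) by (auto simp: bij_betw_def)
      have "w ` {y'. 0 \<le> y' \<and> y' < N \<and> y \<le> w y'} = {z \<in> w ` {..<N}. y \<le> z}"
        by auto
      then have "bij_betw w {y'. 0 \<le> y' \<and> y' < N \<and> y \<le> w y'} {y..<N}"
        unfolding img by (intro bij_betw_imageI inj_on_subset[OF inj]) auto
      from bij_betw_same_card[OF this] show ?thesis by simp
    qed
    then have h0: "tail_count N (sort_state N w 0) y 0 = N - y"
      by (simp add: tail_count_def)
    have "N - y \<le> tail_count N v y y"
    proof -
      have "N - y \<le> tail_count N v y y \<or>
          int T - int y - (if y mod 2 = T mod 2 then 0 else 1) \<le> 2 * int (tail_count N v y y)"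
        using tail_count_sort_state[of y N w y T] y unfolding h0 v_def by simp
      moreover have "(if y mod 2 = T mod 2 then 0 else 1 :: int) \<le> 1"
        by simp
      ultimately show ?thesis
        using y unfolding T_def by linarith
    qed
    moreover have "tail_count N v y y \<le> card {y..<N} "
      unfolding tail_count_def by (intro card_mono) auto
    ultimately have "card {y'. y \<le> y' \<and> y' < N \<and> y \<le> v y'} = card {y..<N}"
      by (simp add: tail_count_def)
    then have "{y'. y \<le> y' \<and> y' < N \<and> y \<le> v y'} = {y..<N}"
      by (intro card_subset_eq) auto
    moreover have "y \<in> {y..<N}" using y by simp
    ultimately have "y \<in> {y'. y \<le> y' \<and> y' < N \<and> y \<le> v y'}" by (simp only:)
    then show ?thesis by simp
  qed
  have bij: "bij_betw v {..<N} {..<N}"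
    unfolding v_def by (rule sort_state_bij[OF assms(1)])
  \<comment> \<open>A permutation with \<open>y \<le> v y\<close> everywhere is the identity,
    because both sides have the same sum.\<close>
  have "(\<Sum>y<N. v y) = (\<Sum>y<N. y)"
    using sum.reindex_bij_betw[OF bij, of "\<lambda>y. y"] by simp
  then have "(\<Sum>y<N. v y - y) = 0"
    using ge by (subst sum_subtractf_nat) auto
  then have "v x \<le> x"
    using assms(2) by simp
  then show ?thesis
    using ge[OF assms(2)] unfolding v_def T_def by simp
qed

lemma route_permutation:
  assumes "\<rho> permutes {..<N}"
  obtains Is where "length Is = 3 * N + 1" "\<forall>I\<in>set Is. gates N I"
    "\<And>a. a < N \<Longrightarrow> fold gate_swap Is a = \<rho> a"
proof
  let ?Is = "sort_rounds N \<rho> (3 * N + 1)"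
  show "length ?Is = 3 * N + 1" "\<forall>I\<in>set ?Is. gates N I"
    by (auto simp: sort_rounds_def gates_sort_gates)
  fix a assume a: "a < N"
  then have "fold gate_swap ?Is a < N"
    by (intro fold_gate_swap_less) (auto simp: sort_rounds_def gates_sort_gates)
  then show "fold gate_swap ?Is a = \<rho> a"
    using sort_state_fold[of N \<rho> "3 * N + 1" a] sort_state_sorted[OF permutes_imp_bij[OF assms]]
    by simp
qed

section \<open>Visiting many sets of positions on a path\<close>

lemma permutes_mapping_exists:
  assumes "finite X" "B \<subseteq> X" "B' \<subseteq> X" "card B = card B'"
  obtains \<mu> where "\<mu> permutes X" "\<mu> ` B = B'"
proof -
  have fin: "finite B" "finite B'" using assms finite_subset by blast+
  have "card (X - B) = card (X - B')"
    using assms fin by (simp add: card_Diff_subset)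
  then obtain f h where f: "bij_betw f B B'" and h: "bij_betw h (X - B) (X - B')"
    using finite_same_card_bij[OF fin assms(4)] finite_same_card_bij[of "X - B" "X - B'"] assms(1) by auto
  define \<mu> where "\<mu> = (\<lambda>x. if x \<in> B then f x else if x \<in> X then h x else x)"
  have 1: "bij_betw \<mu> B B'"
    using f by (subst bij_betw_cong[of _ _ f]) (auto simp: \<mu>_def)
  have 2: "bij_betw \<mu> (X - B) (X - B')"
    using h by (subst bij_betw_cong[of _ _ h]) (auto simp: \<mu>_def)
  have "bij_betw \<mu> (B \<union> (X - B)) (B' \<union> (X - B'))"
    by (rule bij_betw_combine[OF 1 2]) auto
  moreover have "B \<union> (X - B) = X" "B' \<union> (X - B') = X"
    using assms by auto
  ultimately have "\<mu> permutes X"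
    using assms(2) by (intro bij_imp_permutes) (auto simp: \<mu>_def)
  then show ?thesis
    using that 1 by (simp add: bij_betw_def)
qed

lemma permutes_image_subset:
  assumes "\<rho> permutes X" "A \<subseteq> X"
  shows "\<rho> ` A \<subseteq> X" "card (\<rho> ` A) = card A"
  using assms permutes_image[OF assms(1)] permutes_inj_on[OF assms(1)]
  by (auto simp: card_image)

text \<open>The image of a fixed set under a uniformly random permutation is uniform: composition
  with a permutation taking \<open>C\<close> to \<open>D\<close> injects one class into the other,
  so all classes have the same size.\<close>

lemma card_permutations_mapping:
  assumes "finite X" "A \<subseteq> X" "B \<subseteq> X" "card B = card A"
  shows "card {\<rho>. \<rho> permutes X \<and> \<rho> ` A = B} * (card X choose card A) = fact (card X)"
proof -
  let ?K = "{B. B \<subseteq> X \<and> card B = card A}"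
  let ?P = "\<lambda>B. {\<rho>. \<rho> permutes X \<and> \<rho> ` A = B}"
  have le: "card (?P C) \<le> card (?P D)" if C: "C \<in> ?K" and D: "D \<in> ?K" for C D
  proof -
    obtain \<mu> where \<mu>: "\<mu> permutes X" "\<mu> ` C = D"
      using permutes_mapping_exists[OF assms(1), of C D] C D by auto
    have "inj \<mu>" using \<mu>(1) permutes_inj by blast
    show ?thesis
    proof (rule card_inj_on_le[of "\<lambda>\<rho>. \<mu> \<circ> \<rho>"])
      show "inj_on ((\<circ>) \<mu>) (?P C)"
        using \<open>inj \<mu>\<close> by (intro inj_onI) (simp add: inj_eq fun_eq_iff)
      show "(\<circ>) \<mu> ` ?P C \<subseteq> ?P D"
        using \<mu> permutes_compose[of _ X \<mu>] by (auto simp: image_comp[symmetric])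
      show "finite (?P D)"
        by (rule finite_subset[OF _ finite_permutations[OF assms(1)]]) auto
    qed
  qed
  have "fact (card X) = card {\<rho>. \<rho> permutes X}"
    using card_permutations[OF refl assms(1)] by simp
  also have "{\<rho>. \<rho> permutes X} = (\<Union>C\<in>?K. ?P C)"
  proof (intro equalityI subsetI)
    fix \<rho> assume "\<rho> \<in> {\<rho>. \<rho> permutes X}"
    then show "\<rho> \<in> (\<Union>C\<in>?K. ?P C)"
      using permutes_image_subset[of \<rho> X A] assms(2) by (intro UN_I[of "\<rho> ` A"]) simp_all
  qed blast
  also have "card \<dots> = (\<Sum>C\<in>?K. card (?P C))"
    using assms(1) finite_permutations[OF assms(1)]
    by (intro card_UN_disjoint) (auto intro: rev_finite_subset)
  also have "\<dots> = (\<Sum>C\<in>?K. card (?P B))"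
    using le assms by (intro sum.cong refl antisym) auto
  also have "\<dots> = card (?P B) * (card X choose card A)"
    using n_subsets[OF assms(1)] by simp
  finally show ?thesis by simp
qed

lemma card_permutations_into:
  assumes "finite X" "A \<subseteq> X" "finite F"
  shows "card {\<rho>. \<rho> permutes X \<and> \<rho> ` A \<in> F} * (card X choose card A) \<le> card F * fact (card X)"
proof -
  let ?F = "{B \<in> F. B \<subseteq> X \<and> card B = card A}"
  let ?P = "\<lambda>B. {\<rho>. \<rho> permutes X \<and> \<rho> ` A = B}"
  have finP: "finite (?P B)" for B
    by (rule finite_subset[OF _ finite_permutations[OF assms(1)]]) auto
  have "{\<rho>. \<rho> permutes X \<and> \<rho> ` A \<in> F} \<subseteq> (\<Union>B\<in>?F. ?P B)"
  proof
    fix \<rho> assume "\<rho> \<in> {\<rho>. \<rho> permutes X \<and> \<rho> ` A \<in> F}"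
    then show "\<rho> \<in> (\<Union>B\<in>?F. ?P B)"
      using permutes_image_subset[of \<rho> X A] assms(2) by (intro UN_I[of "\<rho> ` A"]) simp_all
  qed
  then have "card {\<rho>. \<rho> permutes X \<and> \<rho> ` A \<in> F} \<le> card (\<Union>B\<in>?F. ?P B)"
    using assms finP by (intro card_mono) auto
  also have "\<dots> \<le> (\<Sum>B\<in>?F. card (?P B))"
    using assms by (intro card_UN_le) auto
  finally have "card {\<rho>. \<rho> permutes X \<and> \<rho> ` A \<in> F} * (card X choose card A)
      \<le> (\<Sum>B\<in>?F. card (?P B)) * (card X choose card A)"
    by simp
  also have "\<dots> = (\<Sum>B\<in>?F. fact (card X))"
    unfolding sum_distrib_right using assms by (intro sum.cong refl card_permutations_mapping) auto
  also have "\<dots> \<le> card F * fact (card X)"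
    using assms by (simp add: card_mono)
  finally show ?thesis .
qed

text \<open>The list grows at its head, so every permutation is tested against those chosen before
  it. Testing one image suffices to compare whole orbits, as these are equal or disjoint.\<close>

fun collisions :: "nat \<Rightarrow> (nat \<Rightarrow> nat) list \<Rightarrow> nat set \<Rightarrow> nat" where
  "collisions N [] A = 0"
| "collisions N (\<rho> # \<rho>s) A = collisions N \<rho>s A +
    (if \<rho> ` A \<in> (\<Union>\<rho>'\<in>set \<rho>s. rotation_orbit N N (\<rho>' ` A)) then 1 else 0)"

text \<open>Each permutation that does not collide contributes an orbit disjoint from the earlier
  ones and of size at least \<open>N / card A\<close>; each colliding one is written off with
  \<open>N\<close>.\<close>

lemma length_le_collisions:
  assumes "A \<subseteq> {..<N}" "A \<noteq> {}" "\<forall>\<rho>\<in>set \<rho>s. \<rho> permutes {..<N}"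
  shows "length \<rho>s * N \<le> collisions N \<rho>s A * N + card A * card (\<Union>\<rho>\<in>set \<rho>s. rotation_orbit N N (\<rho> ` A))"
  using assms(3)
proof (induction \<rho>s)
  case (Cons \<rho> \<rho>s)
  let ?U = "\<Union>\<rho>\<in>set \<rho>s. rotation_orbit N N (\<rho> ` A)"
  have fin: "finite ?U" "finite (rotation_orbit N N (\<rho> ` A))"
    by (auto simp: finite_rotation_orbit)
  show ?case
  proof (cases "\<rho> ` A \<in> ?U")
    case True
    have "card ?U \<le> card (rotation_orbit N N (\<rho> ` A) \<union> ?U)"
      using fin by (intro card_mono) auto
    then have "card A * card ?U \<le> card A * card (rotation_orbit N N (\<rho> ` A) \<union> ?U)"
      by simp
    moreover have "length \<rho>s * N \<le> collisions N \<rho>s A * N + card A * card ?U"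
      using Cons by simp
    ultimately have "length \<rho>s * N \<le> collisions N \<rho>s A * N + card A * card (rotation_orbit N N (\<rho> ` A) \<union> ?U)"
      by linarith
    then show ?thesis using True by simp
  next
    case False
    have sub: "\<rho>' ` A \<subseteq> {..<N}" if "\<rho>' \<in> set (\<rho> # \<rho>s)" for \<rho>'
      using that Cons.prems assms(1) permutes_image by blast
    have "rotation_orbit N N (\<rho> ` A) \<inter> ?U = {}"
      using rotation_orbit_disjoint[OF sub sub] False by fastforce
    then have "card (rotation_orbit N N (\<rho> ` A) \<union> ?U) = card (rotation_orbit N N (\<rho> ` A)) + card ?U"
      using fin by (intro card_Un_disjoint) auto
    moreover have "card (\<rho> ` A) = card A"
      using Cons.prems permutes_inj_on by (intro card_image) auto
    then have "N \<le> card A * card (rotation_orbit N N (\<rho> ` A))"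
      using card_rotation_orbit_ge[OF sub, of \<rho> N] assms(2) by auto
    ultimately show ?thesis using Cons False by (simp add: algebra_simps)
  qed
qed auto

text \<open>
  Adding a uniformly random permutation at most doubles the potential \<open>\<Sum>A. Y ^ collisions A\<close> on
  average, since it collides for a given \<open>A\<close> with probability at most \<open>1 / Y\<close>.
\<close>

lemma few_collisions_exist:
  fixes Y :: real
  assumes "Y \<ge> 0" "Y * (m * N) \<le> real (N choose k)" "k \<le> N"
  shows "\<exists>\<rho>s. length \<rho>s = m \<and> (\<forall>\<rho>\<in>set \<rho>s. \<rho> permutes {..<N}) \<and>
    (\<Sum>A | A \<subseteq> {..<N} \<and> card A = k. Y ^ collisions N \<rho>s A) \<le> 2 ^ m * real (N choose k)"
  using assms(2)
proof (induction m)
  case 0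
  have "card {A. A \<subseteq> {..<N} \<and> card A = k} = N choose k"
    using n_subsets[of "{..<N}" k] by simp
  then show ?case by simp
next
  case (Suc m)
  have "Y * (real m * real N) \<le> Y * (real (Suc m) * real N)"
    using assms(1) by (intro mult_left_mono mult_right_mono) auto
  then have "Y * (real m * real N) \<le> real (N choose k)"
    by (rule order_trans[OF _ Suc.prems])
  from Suc.IH[OF this] obtain \<rho>s where \<rho>s: "length \<rho>s = m" "\<forall>\<rho>\<in>set \<rho>s. \<rho> permutes {..<N}"
    "(\<Sum>A | A \<subseteq> {..<N} \<and> card A = k. Y ^ collisions N \<rho>s A) \<le> 2 ^ m * real (N choose k)"
    by blast
  define P where "P = {\<rho>. \<rho> permutes {..<N}}"
  define K where "K = {A. A \<subseteq> {..<N} \<and> card A = k}"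
  define W where "W = (\<Sum>A\<in>K. Y ^ collisions N \<rho>s A)"
  have P: "finite P" "card P = fact N"
    unfolding P_def using finite_permutations[of "{..<N}"] card_permutations[of "{..<N}" N] by auto
  have pos: "0 < real (N choose k)"
    using assms(3) by simp
  have avg: "(\<Sum>\<rho>\<in>P. Y ^ collisions N (\<rho> # \<rho>s) A) \<le> fact N * (2 * Y ^ collisions N \<rho>s A)" if "A \<in> K" for A
  proof -
    define F where "F = (\<Union>\<rho>'\<in>set \<rho>s. rotation_orbit N N (\<rho>' ` A))"
    \<comment> \<open>The earlier orbits cover at most \<open>m * N\<close> sets, which with the
      hypothesis on \<open>Y\<close> bounds the collision probability by
      \<open>1 / Y\<close>.\<close>
    have "card F \<le> (\<Sum>\<rho>'\<in>set \<rho>s. card (rotation_orbit N N (\<rho>' ` A)))"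
      unfolding F_def by (intro card_UN_le) auto
    also have "\<dots> \<le> (\<Sum>\<rho>'\<in>set \<rho>s. N)"
      by (intro sum_mono card_rotation_orbit_le)
    also have "\<dots> \<le> m * N"
      using \<rho>s(1) card_length[of \<rho>s] by simp
    finally have cF: "card F \<le> Suc m * N" by simp
    have finF: "finite F" by (auto simp: F_def finite_rotation_orbit)
    have sub: "{\<rho>. \<rho> permutes {..<N} \<and> \<rho> ` A \<in> F} = {\<rho>\<in>P. \<rho> ` A \<in> F}"
      by (auto simp: P_def)
    have "card {\<rho>\<in>P. \<rho> ` A \<in> F} * (N choose k) \<le> card F * fact N"
      using card_permutations_into[of "{..<N}" A F] that finF sub by (auto simp: K_def)
    also have "\<dots> \<le> Suc m * N * fact N"
      using cF by (intro mult_right_mono) auto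
    finally have "real (card {\<rho>\<in>P. \<rho> ` A \<in> F} * (N choose k)) \<le> real (Suc m * N * fact N)"
      by (simp only: of_nat_le_iff)
    then have "Y * (real (card {\<rho>\<in>P. \<rho> ` A \<in> F}) * real (N choose k)) \<le> Y * (real (Suc m * N) * fact N)"
      using assms(1) by (intro mult_left_mono) (simp_all only: of_nat_mult of_nat_fact)
    also have "\<dots> = (Y * real (Suc m * N)) * fact N"
      by simp
    also have "\<dots> \<le> real (N choose k) * fact N"
      unfolding of_nat_mult by (intro mult_right_mono[OF Suc.prems]) auto
    finally have "real (N choose k) * (Y * real (card {\<rho>\<in>P. \<rho> ` A \<in> F})) \<le> real (N choose k) * fact N"
      by (simp only: mult.assoc mult.commute mult.left_commute)
    then have cnt: "Y * real (card {\<rho>\<in>P. \<rho> ` A \<in> F}) \<le> fact N"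
      using pos by (simp only: mult_le_cancel_left_pos)
    have "(\<Sum>\<rho>\<in>P. Y ^ collisions N (\<rho> # \<rho>s) A) \<le>
        (\<Sum>\<rho>\<in>P. Y ^ collisions N \<rho>s A * (1 + (if \<rho> ` A \<in> F then Y else 0)))"
      using assms(1) by (intro sum_mono) (auto simp: F_def[symmetric] algebra_simps)
    also have "\<dots> = Y ^ collisions N \<rho>s A * (fact N + Y * real (card {\<rho>\<in>P. \<rho> ` A \<in> F}))"
      using P by (simp add: sum_distrib_left[symmetric] sum.distrib sum.If_cases Int_def mult.commute)
    also have "\<dots> \<le> Y ^ collisions N \<rho>s A * (fact N + fact N)"
      using cnt assms(1) by (intro mult_left_mono add_left_mono) auto
    also have "\<dots> = fact N * (2 * Y ^ collisions N \<rho>s A)"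
      by simp
    finally show ?thesis .
  qed
  have "\<exists>\<rho>\<in>P. (\<Sum>A\<in>K. Y ^ collisions N (\<rho> # \<rho>s) A) \<le> 2 * W"
  proof (rule ccontr)
    assume "\<not> ?thesis"
    then have "(\<Sum>\<rho>\<in>P. 2 * W) < (\<Sum>\<rho>\<in>P. \<Sum>A\<in>K. Y ^ collisions N (\<rho> # \<rho>s) A)"
      using P by (intro sum_strict_mono) (auto simp: not_le)
    also have "\<dots> = (\<Sum>A\<in>K. \<Sum>\<rho>\<in>P. Y ^ collisions N (\<rho> # \<rho>s) A)"
      by (rule sum.swap)
    also have "\<dots> \<le> (\<Sum>A\<in>K. fact N * (2 * Y ^ collisions N \<rho>s A))"
      by (intro sum_mono avg)
    also have "\<dots> = (\<Sum>\<rho>\<in>P. 2 * W)"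
      using P by (simp add: W_def sum_distrib_left mult.assoc)
    finally show False by simp
  qed
  then obtain \<rho> where "\<rho> \<in> P" "(\<Sum>A\<in>K. Y ^ collisions N (\<rho> # \<rho>s) A) \<le> 2 * W"
    by blast
  then show ?case
    using \<rho>s unfolding P_def K_def W_def by (intro exI[of _ "\<rho> # \<rho>s"]) auto
qed

section \<open>Sets of positions visited by a path schedule\<close>

definition path_visits :: "nat set list \<Rightarrow> nat set \<Rightarrow> nat set set" where
  "path_visits Is A = (\<lambda>t. fold gate_swap (take t Is) ` A) ` {..length Is}"

lemma rotation_orbit_subset_path_visits:
  "rotation_orbit N s (fold gate_swap Is ` A) \<subseteq> path_visits (Is @ rotation N s) A"
proof
  fix C assume "C \<in> rotation_orbit N s (fold gate_swap Is ` A)"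
  then obtain l where l: "l < s" "C = rotate_by N l ` fold gate_swap Is ` A"
    by (auto simp: rotation_orbit_def)
  then have "C = fold gate_swap (take (length Is + 2 * l) (Is @ rotation N s)) ` A"
    by (simp add: take_rotation image_image)
  moreover have "length Is + 2 * l \<le> length (Is @ rotation N s)"
    using l(1) by (simp add: length_rotation)
  ultimately show "C \<in> path_visits (Is @ rotation N s) A"
    unfolding path_visits_def by blast
qed

lemma path_visits_subset:
  assumes "C \<in> path_visits Is A" "\<forall>I\<in>set Is. gates N I" "A \<subseteq> {..<N}"
  shows "C \<subseteq> {..<N}" "card C = card A"
proof -
  obtain t where C: "C = fold gate_swap (take t Is) ` A"
    using assms(1) by (auto simp: path_visits_def)
  have g: "\<forall>I\<in>set (take t Is). gates N I"
    using assms(2) by (auto dest: in_set_takeD)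
  show "C \<subseteq> {..<N}"
    using C assms(3) fold_gate_swap_less[OF g] by auto
  show "card C = card A"
    unfolding C by (intro card_image inj_on_subset[OF inj_fold_gate_swap[OF g]]) auto
qed

text \<open>Each block is judged from the same initial arrangement; the return to it is added later,
  and the \<open>Suc\<close> pays for one extra round in front of each block. A routed block has
  about \<open>5 * N\<close> rounds and visits a whole orbit, so few collisions keep the cost per
  visited set bounded in terms of \<open>k\<close>.\<close>

theorem path_schedule:
  assumes "2 \<le> k" "k \<le> N" "(16 * (k + 1) * k ^ k)\<^sup>2 \<le> N" "1 \<le> L" "k * L \<le> N ^ (k - 1)"
  shows "\<exists>blocks. (\<forall>Is\<in>set blocks. \<forall>I\<in>set Is. gates N I) \<and>
    sum_list (map (\<lambda>Is. Suc (length Is)) blocks) \<le> 28 * k * (k + 1) * L \<and>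
    (\<forall>A. A \<subseteq> {..<N} \<and> card A = k \<longrightarrow> L \<le> card (\<Union>Is\<in>set blocks. path_visits Is A))"
proof (cases "k * L \<le> N")
  case True
  have "L \<le> card (path_visits (rotation N (k * L)) A)" if A: "A \<subseteq> {..<N}" "card A = k" for A
  proof -
    have "A \<noteq> {}" using A(2) assms(1) by auto
    from card_rotation_orbit_ge[OF A(1) this True] have "L \<le> card (rotation_orbit N (k * L) A)"
      using A(2) assms(1) by simp
    also have "\<dots> \<le> card (path_visits (rotation N (k * L)) A)"
      using rotation_orbit_subset_path_visits[of N "k * L" "[]" A]
      by (intro card_mono) (auto simp: path_visits_def)
    finally show ?thesis .
  qed
  moreover have "Suc (2 * (k * L)) \<le> 28 * k * (k + 1) * L"
  proof -
    have "1 \<le> k * L" using assms by simp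
    then have "Suc (2 * (k * L)) \<le> 28 * (k * L)" by simp
    also have "\<dots> \<le> (k + 1) * (28 * (k * L))" by simp
    finally show ?thesis by (simp add: algebra_simps)
  qed
  ultimately show ?thesis
    using gates_rotation by (intro exI[of _ "[rotation N (k * L)]"]) (auto simp: length_rotation)
next
  case False
  have N: "N > 0" using assms by simp
  have k3: "3 \<le> k"
  proof (rule ccontr)
    assume "\<not> 3 \<le> k"
    then have "k = 2" using assms(1) by simp
    then show False using assms(5) False by simp
  qed
  then have powk: "N ^ (k - 1) = N ^ (k - 2) * N"
    by (simp flip: power_Suc2 add: numeral_2_eq_2 Suc_diff_Suc)
  \<comment> \<open>More than half of the \<open>m\<close> blocks will bring new orbits of at least
    \<open>N / k\<close> sets, so about \<open>2 * k * L / N\<close> blocks are enough for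
    \<open>L\<close> sets. The surplus \<open>4 * k + 2\<close> makes the potential argument
    work.\<close>
  define m where "m = 2 * k * L div N + (4 * k + 2)"
  have mN: "2 * k * L \<le> m * N"
  proof -
    have "2 * k * L mod N \<le> (4 * k + 2) * N"
    proof (rule order.trans)
      show "2 * k * L mod N \<le> N"
        by (rule less_imp_le[OF mod_less_divisor[OF N]])
      show "N \<le> (4 * k + 2) * N"
        by (simp only: add_mult_distrib)
    qed
    moreover have "2 * k * L div N * N + 2 * k * L mod N = 2 * k * L"
      by (rule div_mult_mod_eq)
    moreover have "m * N = 2 * k * L div N * N + (4 * k + 2) * N"
      unfolding m_def by (rule add_mult_distrib)
    ultimately show ?thesis by linarith
  qed
  have "2 * k * L div N \<le> 2 * N ^ (k - 2) * N div N"
    using assms(5) powk by (intro div_le_mono) simp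
  also have "\<dots> = 2 * N ^ (k - 2)" using N by simp
  finally have "m \<le> 2 * N ^ (k - 2) + (4 * k + 2) * 1"
    unfolding m_def by simp
  also have "\<dots> \<le> 2 * N ^ (k - 2) + (4 * k + 2) * N ^ (k - 2)"
    using N by (intro add_left_mono mult_left_mono) auto
  finally have m_le: "m \<le> (4 * k + 4) * N ^ (k - 2)"
    by (simp add: algebra_simps)
  \<comment> \<open>With collision weight \<open>4 * sqrt N = (2 * y)\<^sup>2\<close>, the value
    \<open>(2 * y) ^ m\<close> of a bad set is compared with
    \<open>2 ^ m * N ^ k = 2 ^ m * y ^ (4 * k)\<close>; the fourth root turns both into powers of
    \<open>y\<close>.\<close>
  define y where "y = sqrt (sqrt N)"
  have y2: "y\<^sup>2 = sqrt N" and y4: "y ^ 4 = N"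
  proof -
    show "y\<^sup>2 = sqrt N" by (simp add: y_def)
    then have "(y\<^sup>2)\<^sup>2 = N" by simp
    then show "y ^ 4 = N" by (simp add: power_mult[symmetric])
  qed
  have "16 * (k + 1) * 1 \<le> 16 * (k + 1) * k ^ k"
    using assms(1) by (intro mult_left_mono) auto
  moreover have "1 < 16 * (k + 1) * 1"
    by simp
  ultimately have "1 < 16 * (k + 1) * k ^ k"
    by (rule less_le_trans[rotated])
  then have "1 < (16 * (k + 1) * k ^ k)\<^sup>2"
    by (intro one_less_power) simp_all
  then have "1 < N" using assms(3) by linarith
  then have y1: "1 < y" by (simp add: y_def)
  \<comment> \<open>The orbits cover order \<open>N ^ (k - 1)\<close> of the order
    \<open>N ^ k\<close> sets, which leaves a spare factor \<open>N\<close>: one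
    \<open>sqrt N\<close> of it is the weight, the other absorbs the constants by the size
    hypothesis on \<open>N\<close>.\<close>
  have "4 * y\<^sup>2 * (m * N) \<le> real (N choose k)"
  proof -
    have "real (16 * (k + 1) * k ^ k) \<le> sqrt N"
      using assms(3) by (intro real_le_rsqrt) (metis of_nat_le_iff of_nat_power)
    then have "real (16 * (k + 1) * k ^ k) * sqrt N \<le> sqrt N * sqrt N"
      by (intro mult_right_mono) auto
    then have *: "16 * (real k + 1) * real k ^ k * sqrt N \<le> N"
      by (simp add: add.commute)
    have "4 * y\<^sup>2 * (m * N) \<le> 4 * sqrt N * (real ((4 * k + 4) * N ^ (k - 2)) * N)"
      unfolding y2 of_nat_mult[of m] using m_le by (intro mult_left_mono mult_right_mono of_nat_mono) auto
    also have "\<dots> = 16 * (real k + 1) * sqrt N * real N ^ (k - 1)"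
    proof -
      have "real N ^ (k - 1) = real N ^ (k - 2) * real N"
        using powk by (metis of_nat_mult of_nat_power)
      then show ?thesis by (simp add: algebra_simps)
    qed
    also have "\<dots> \<le> real N * real N ^ (k - 1) / real k ^ k"
      using mult_right_mono[OF *, of "real N ^ (k - 1)"] assms(1)
      by (simp add: field_simps)
    also have "\<dots> = (real N / real k) ^ k"
      using assms(1) by (simp add: power_divide flip: power_Suc)
    also have "\<dots> \<le> real (N choose k)"
      using binomial_ge_n_over_k_pow_k[OF assms(2), where 'a=real] by simp
    finally show ?thesis .
  qed
  then obtain \<rho>s where \<rho>s: "length \<rho>s = m" "\<forall>\<rho>\<in>set \<rho>s. \<rho> permutes {..<N}"
    "(\<Sum>A | A \<subseteq> {..<N} \<and> card A = k. (4 * y\<^sup>2) ^ collisions N \<rho>s A) \<le> 2 ^ m * real (N choose k)"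
    using few_collisions_exist[of "4 * y\<^sup>2" m N k] assms(2) by auto
  have "\<exists>Is. length Is = 3 * N + 1 \<and> (\<forall>I\<in>set Is. gates N I) \<and> (\<forall>a<N. fold gate_swap Is a = \<rho> a)"
    if "\<rho> permutes {..<N}" for \<rho>
    using route_permutation[OF that] by metis
  then obtain route where route: "\<And>\<rho>. \<rho> permutes {..<N} \<Longrightarrow> length (route \<rho>) = 3 * N + 1 \<and>
      (\<forall>I\<in>set (route \<rho>). gates N I) \<and> (\<forall>a<N. fold gate_swap (route \<rho>) a = \<rho> a)"
    by metis
  define blocks where "blocks = map (\<lambda>\<rho>. route \<rho> @ rotation N N) \<rho>s"
  have valid: "\<forall>Is\<in>set blocks. \<forall>I\<in>set Is. gates N I"
    using route \<rho>s(2) gates_rotation by (auto simp: blocks_def)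
  have "sum_list (map (\<lambda>Is. Suc (length Is)) blocks) = (\<Sum>\<rho>\<leftarrow>\<rho>s. 5 * N + 2)"
    unfolding blocks_def map_map comp_def
    using route \<rho>s(2) by (intro arg_cong[of _ _ sum_list] map_cong refl) (auto simp: length_rotation)
  also have "\<dots> = m * (5 * N + 2)"
    using \<rho>s(1) by (simp add: sum_list_triv)
  also have "\<dots> \<le> 7 * (m * N)"
    using N by (simp add: algebra_simps)
  \<comment> \<open>The surplus blocks cost order \<open>k * N\<close> rounds each time
    \<open>N\<close> is charged, which is affordable since \<open>N < k * L\<close> in this
    case.\<close>
  also have "m * N \<le> 2 * k * L + (4 * k + 2) * (k * L)"
  proof -
    have "m * N = 2 * k * L div N * N + (4 * k + 2) * N"
      by (simp add: m_def algebra_simps)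
    also have "\<dots> \<le> 2 * k * L + (4 * k + 2) * (k * L)"
      using False by (intro add_mono mult_left_mono div_times_less_eq_dividend) auto
    finally show ?thesis .
  qed
  finally have len: "sum_list (map (\<lambda>Is. Suc (length Is)) blocks) \<le> 28 * k * (k + 1) * L"
    by (simp add: algebra_simps)
  have "L \<le> card (\<Union>Is\<in>set blocks. path_visits Is A)" if A: "A \<subseteq> {..<N}" "card A = k" for A
  proof -
    define c where "c = collisions N \<rho>s A"
    define U where "U = (\<Union>\<rho>\<in>set \<rho>s. rotation_orbit N N (\<rho> ` A))"
    \<comment> \<open>If half of the permutations collided, the single term of \<open>A\<close> in
      the potential would be at least \<open>(2 * y) ^ m\<close>, giving
      \<open>m \<le> 4 * k\<close> against the choice of \<open>m\<close>.\<close>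
    have "2 * c < m"
    proof (rule ccontr)
      assume "\<not> 2 * c < m"
      then have "(2 * y) ^ m \<le> (2 * y) ^ (2 * c)"
        using y1 by (intro power_increasing) auto
      also have "\<dots> = (4 * y\<^sup>2) ^ c"
        by (simp add: power_mult power_mult_distrib)
      also have "\<dots> \<le> (\<Sum>A | A \<subseteq> {..<N} \<and> card A = k. (4 * y\<^sup>2) ^ collisions N \<rho>s A)"
        unfolding c_def using A by (intro member_le_sum) auto
      also have "\<dots> \<le> 2 ^ m * real (N choose k)"
        by (fact \<rho>s(3))
      also have "real (N choose k) \<le> real (N ^ k)"
        using binomial_le_pow[OF assms(2)] by simp
      also have "real (N ^ k) = y ^ (4 * k)"
        using y4 by (simp add: power_mult)
      finally have "y ^ m \<le> y ^ (4 * k)"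
        by (simp add: power_mult_distrib)
      then have "m \<le> 4 * k"
        using y1 by simp
      then show False by (simp add: m_def)
    qed
    have "A \<noteq> {}" using A(2) assms(1) by auto
    from length_le_collisions[OF A(1) this \<rho>s(2)]
    have "m * N \<le> c * N + k * card U"
      using \<rho>s(1) A(2) by (simp add: U_def c_def)
    moreover have "2 * (c * N) \<le> m * N"
      using \<open>2 * c < m\<close> by (simp flip: mult.assoc)
    ultimately have "2 * (k * L) \<le> 2 * (k * card U)"
      using mN by linarith
    then have "L \<le> card U" using assms(1) by simp
    also have "\<dots> \<le> card (\<Union>Is\<in>set blocks. path_visits Is A)"
    proof (rule card_mono)
      show "finite (\<Union>Is\<in>set blocks. path_visits Is A)"
        by (auto simp: path_visits_def)
      have "rotation_orbit N N (\<rho> ` A) \<subseteq> path_visits (route \<rho> @ rotation N N) A" if "\<rho> \<in> set \<rho>s" for \<rho>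
      proof -
        have "\<rho> ` A = fold gate_swap (route \<rho>) ` A"
          using route[of \<rho>] that \<rho>s(2) A(1) by (intro image_cong) auto
        then show ?thesis
          using rotation_orbit_subset_path_visits by metis
      qed
      then show "U \<subseteq> (\<Union>Is\<in>set blocks. path_visits Is A)"
        unfolding U_def blocks_def by fastforce
    qed
    finally show ?thesis .
  qed
  then show ?thesis using valid len by blast
qed

section \<open>Schedules on hypergraphs with a long path\<close>

lemma swap_along_eqI:
  assumes "swap_matching E M" "{u, v} \<in> M" "u \<noteq> v"
  shows "swap_along M v = u"
proof -
  have unique: "u' = u" if "{u', v} \<in> M" for u'
  proof -
    have "\<not> disjnt {u', v} {u, v}" by (simp add: disjnt_def)
    moreover have "pairwise disjnt M"
      using assms(1) by (simp add: swap_matching_def)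
    ultimately have "{u', v} = {u, v}"
      using pairwiseD[OF _ that assms(2)] by metis
    then show ?thesis by (auto simp: doubleton_eq_iff)
  qed
  have "(THE u. u \<noteq> v \<and> {u, v} \<in> M) = u"
  proof (rule the_equality)
    show "u \<noteq> v \<and> {u, v} \<in> M" using assms(2,3) by simp
  qed (use unique in blast)
  moreover have "\<exists>u. u \<noteq> v \<and> {u, v} \<in> M"
    using assms(2,3) by blast
  ultimately show ?thesis
    by (simp only: swap_along_def if_True)
qed

lemma swap_along_fixed: "v \<notin> \<Union>M \<Longrightarrow> swap_along M v = v"
  by (auto simp: swap_along_def)

lemma swap_along_cases:
  assumes "swap_matching E M"
  obtains "swap_along M v = v" | u where "u \<noteq> v" "{u, v} \<in> M" "swap_along M v = u"
  using swap_along_eqI[OF assms] by (cases "\<exists>u. u \<noteq> v \<and> {u, v} \<in> M") (auto simp: swap_along_def)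

lemma swap_along_involution:
  assumes "swap_matching E M"
  shows "swap_along M (swap_along M v) = v"
  using assms
proof (cases rule: swap_along_cases[of E M v])
  case (2 u)
  then show ?thesis
    using swap_along_eqI[OF assms, of v u] by (simp add: insert_commute)
qed auto

lemma swap_along_in:
  assumes "swap_matching E M" "\<Union>E \<subseteq> V" "v \<in> V"
  shows "swap_along M v \<in> V"
  using assms(1)
proof (cases rule: swap_along_cases[of E M v])
  case (2 u)
  then show ?thesis
    using assms unfolding swap_matching_def by (metis Union_iff insertI1 subset_iff)
qed (use assms in simp)

lemma agent_position_append: "agent_position (Ms @ Ns) a = agent_position Ns (agent_position Ms a)"
  by (simp add: agent_position_def)

lemma agent_position_undo:
  "\<forall>M\<in>set Ms. swap_matching E M \<Longrightarrow> agent_position (Ms @ rev Ms) a = a"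
  by (induction Ms arbitrary: a) (auto simp: agent_position_def swap_along_involution)

lemma inj_agent_position:
  assumes "\<forall>M\<in>set Ms. swap_matching E M"
  shows "inj (agent_position Ms)"
  by (rule inj_on_inverseI[where g="agent_position (rev Ms)"])
     (use agent_position_undo[OF assms] in \<open>simp add: agent_position_append\<close>)

lemma agent_position_in:
  "\<forall>M\<in>set Ms. swap_matching E M \<Longrightarrow> \<Union>E \<subseteq> V \<Longrightarrow> a \<in> V \<Longrightarrow> agent_position Ms a \<in> V"
  by (induction Ms arbitrary: a) (auto simp: agent_position_def swap_along_in)

definition visits :: "'a set set list \<Rightarrow> 'a set \<Rightarrow> 'a set set" where
  "visits Ms A = (\<lambda>t. agent_position (take t Ms) ` A) ` {..length Ms}"

lemma acquainted_iff_visits: "acquainted E Ms A \<longleftrightarrow> (\<exists>B\<in>visits Ms A. \<exists>e\<in>E. B \<subseteq> e)"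
  by (auto simp: acquainted_def visits_def)

lemma finite_visits: "finite (visits Ms A)"
  by (simp add: visits_def)

lemma visits_subset:
  assumes "B \<in> visits Ms A" "\<forall>M\<in>set Ms. swap_matching E M" "\<Union>E \<subseteq> V" "A \<subseteq> V"
  shows "B \<subseteq> V" "card B = card A"
proof -
  obtain t where B: "B = agent_position (take t Ms) ` A"
    using assms(1) by (auto simp: visits_def)
  have t: "\<forall>M\<in>set (take t Ms). swap_matching E M"
    using assms(2) by (auto dest: in_set_takeD)
  show "B \<subseteq> V"
    using B agent_position_in[OF t assms(3)] assms(4) by auto
  show "card B = card A"
    unfolding B by (intro card_image inj_on_subset[OF inj_agent_position[OF t]]) auto
qed

lemma visits_append1: "visits Ms A \<subseteq> visits (Ms @ Ns) A"
proof
  fix B assume "B \<in> visits Ms A"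
  then obtain t where "t \<le> length Ms" "B = agent_position (take t Ms) ` A"
    by (auto simp: visits_def)
  then show "B \<in> visits (Ms @ Ns) A"
    unfolding visits_def by (intro image_eqI[where x=t]) auto
qed

lemma visits_append2: "visits Ns (agent_position Ms ` A) \<subseteq> visits (Ms @ Ns) A"
proof
  fix B assume "B \<in> visits Ns (agent_position Ms ` A)"
  then obtain t where t: "t \<le> length Ns" "B = agent_position (take t Ns) ` agent_position Ms ` A"
    by (auto simp: visits_def)
  then have "B = agent_position (take (length Ms + t) (Ms @ Ns)) ` A"
    by (simp add: image_image agent_position_append)
  then show "B \<in> visits (Ms @ Ns) A"
    using t(1) unfolding visits_def by (intro image_eqI[where x="length Ms + t"]) auto
qed

text \<open>Every round is an involution, so playing a block backwards returns all agents to their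
  starting vertices, and each block can be analysed as if it came first.\<close>

definition with_undo :: "'a set set list list \<Rightarrow> 'a set set list" where
  "with_undo blocks = concat (map (\<lambda>Ms. Ms @ rev Ms) blocks)"

lemma agent_position_with_undo:
  "\<forall>Ms\<in>set blocks. \<forall>M\<in>set Ms. swap_matching E M \<Longrightarrow> agent_position (with_undo blocks) a = a"
proof (induction blocks)
  case (Cons Ms blocks)
  have "with_undo (Ms # blocks) = (Ms @ rev Ms) @ with_undo blocks"
    by (simp add: with_undo_def)
  moreover have "agent_position (Ms @ rev Ms) a = a"
    using Cons.prems by (intro agent_position_undo) auto
  moreover have "agent_position (with_undo blocks) a = a"
    using Cons by simp
  ultimately show ?case
    by (metis agent_position_append)
qed (simp add: with_undo_def agent_position_def)

lemma visits_with_undo: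
  assumes "\<forall>Ms\<in>set blocks. \<forall>M\<in>set Ms. swap_matching E M" "Ms \<in> set blocks"
  shows "visits Ms A \<subseteq> visits (with_undo blocks) A"
proof -
  obtain xs ys where split: "blocks = xs @ Ms # ys"
    using assms(2) by (meson split_list)
  then have eq: "with_undo blocks = with_undo xs @ Ms @ (rev Ms @ with_undo ys)"
    by (simp add: with_undo_def)
  have "agent_position (with_undo xs) ` A = A"
    using agent_position_with_undo[of xs E] assms(1) split by (simp add: ball_Un)
  then show ?thesis
    using visits_append1[of Ms A "rev Ms @ with_undo ys"]
      visits_append2[of "Ms @ (rev Ms @ with_undo ys)" "with_undo xs" A]
    by (simp add: eq)
qed

lemma length_with_undo: "length (with_undo blocks) = 2 * sum_list (map length blocks)"
  by (induction blocks) (auto simp: with_undo_def)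

lemma set_with_undo: "set (with_undo blocks) = (\<Union>Ms\<in>set blocks. set Ms)"
  by (auto simp: with_undo_def)

text \<open>This is the 2-section of the hypergraph: two distinct vertices may exchange their agents
  exactly if they are adjacent in it.\<close>

definition adjacent :: "'a set set \<Rightarrow> 'a \<Rightarrow> 'a \<Rightarrow> bool" where
  "adjacent E u v \<longleftrightarrow> (\<exists>e\<in>E. {u, v} \<subseteq> e)"

lemma adjacent_commute: "adjacent E u v \<longleftrightarrow> adjacent E v u"
  by (auto simp: adjacent_def)

definition is_path :: "'a set set \<Rightarrow> nat \<Rightarrow> (nat \<Rightarrow> 'a) \<Rightarrow> bool" where
  "is_path E N g \<longleftrightarrow> inj_on g {..<N} \<and> (\<forall>i. Suc i < N \<longrightarrow> adjacent E (g i) (g (Suc i)))"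

definition path_round :: "(nat \<Rightarrow> 'a) \<Rightarrow> nat set \<Rightarrow> 'a set set" where
  "path_round g I = (\<lambda>i. {g i, g (Suc i)}) ` I"

lemma swap_matching_path_round:
  assumes "is_path E N g" "gates N I"
  shows "swap_matching E (path_round g I)"
proof -
  have inj: "g i = g j \<longleftrightarrow> i = j" if "i < N" "j < N" for i j
    using assms(1) that by (auto simp: is_path_def inj_on_def)
  have lt: "i < N" "Suc i < N" "Suc i \<notin> I" if "i \<in> I" for i
    using assms(2) that by (auto simp: gates_def)
  have "card {g i, g (Suc i)} = 2" if "i \<in> I" for i
    using inj[of i "Suc i"] lt[OF that] by simp
  moreover have "\<exists>e\<in>E. {g i, g (Suc i)} \<subseteq> e" if "i \<in> I" for i
    using assms(1) lt[OF that] unfolding is_path_def adjacent_def by blast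
  moreover have "disjnt {g i, g (Suc i)} {g j, g (Suc j)}" if "i \<in> I" "j \<in> I" "i \<noteq> j" for i j
    using inj lt[OF that(1)] lt[OF that(2)] that by (auto simp: disjnt_def)
  ultimately show ?thesis
    unfolding swap_matching_def path_round_def pairwise_def by blast
qed

lemma swap_along_path_round:
  assumes "is_path E N g" "gates N I" "i < N"
  shows "swap_along (path_round g I) (g i) = g (gate_swap I i)"
proof -
  note M = swap_matching_path_round[OF assms(1,2)]
  have inj: "g i = g j \<longleftrightarrow> i = j" if "i < N" "j < N" for i j
    using assms(1) that by (auto simp: is_path_def inj_on_def)
  have lt: "Suc i < N" if "i \<in> I" for i
    using assms(2) that by (auto simp: gates_def)
  consider "i \<in> I" | j where "i = Suc j" "j \<in> I" "i \<notin> I" | "i \<notin> I" "i = 0 \<or> i - 1 \<notin> I"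
    by (cases i) auto
  then show ?thesis
  proof cases
    case 1
    then have "{g (Suc i), g i} \<in> path_round g I"
      by (auto simp: path_round_def)
    then show ?thesis
      using swap_along_eqI[OF M] inj[of "Suc i" i] lt[OF 1] 1 by (simp add: gate_swap_def)
  next
    case 2
    then have "{g j, g i} \<in> path_round g I"
      by (auto simp: path_round_def)
    then show ?thesis
      using swap_along_eqI[OF M, of "g j" "g i"] inj[of j i] lt[of j] 2 by (simp add: gate_swap_def)
  next
    case 3
    have "g i \<noteq> g j \<and> g i \<noteq> g (Suc j)" if "j \<in> I" for j
      using that inj[of i j] inj[of i "Suc j"] lt[OF that] assms(3) 3 by auto
    then have "g i \<notin> \<Union>(path_round g I)"
      by (auto simp: path_round_def)
    then show ?thesis
      using 3 by (auto simp: swap_along_fixed gate_swap_def)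
  qed
qed

lemma agent_position_path:
  assumes "is_path E N g"
  shows "\<forall>I\<in>set Is. gates N I \<Longrightarrow> i < N \<Longrightarrow> agent_position (map (path_round g) Is) (g i) = g (fold gate_swap Is i)"
  by (induction Is arbitrary: i)
     (auto simp: agent_position_def swap_along_path_round[OF assms] gate_swap_less)

lemma visits_path:
  assumes "is_path E N g" "\<forall>I\<in>set Is. gates N I" "A \<subseteq> {..<N}"
  shows "visits (map (path_round g) Is) (g ` A) = (`) g ` path_visits Is A"
proof -
  have "agent_position (map (path_round g) (take t Is)) ` g ` A = g ` fold gate_swap (take t Is) ` A" for t
    unfolding image_image using assms
    by (intro image_cong agent_position_path[OF assms(1)]) (auto dest: in_set_takeD)
  then show ?thesis
    by (simp add: visits_def path_visits_def image_image take_map)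
qed

text \<open>
  The agents off the path enter it through one of \<open>k\<close> matchings with disjoint images: an agent set
  \<open>A\<close> of size \<open>k\<close> not already on the path misses one of these images, and after swapping along
  that matching all of \<open>A\<close> is on the path.
\<close>

theorem hypergraph_schedule:
  fixes E :: "'a set set" and g :: "nat \<Rightarrow> 'a" and f :: "'a \<times> nat \<Rightarrow> 'a"
  assumes "finite V" and path: "is_path E N g" and R: "R = V - g ` {..<N}"
    and f: "inj_on f (R \<times> {..<k})" "\<And>v i. v \<in> R \<Longrightarrow> i < k \<Longrightarrow> f (v, i) \<in> g ` {..<N} \<and> adjacent E v (f (v, i))"
    and "2 \<le> k" "k \<le> N" "(16 * (k + 1) * k ^ k)\<^sup>2 \<le> N" "1 \<le> L" "k * L \<le> N ^ (k - 1)"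
  shows "\<exists>Ms. (\<forall>M\<in>set Ms. swap_matching E M) \<and> length Ms \<le> 56 * k * (k + 1)\<^sup>2 * L \<and>
    (\<forall>A. A \<subseteq> V \<and> card A = k \<longrightarrow> L \<le> card (visits Ms A))"
proof -
  obtain gblocks where gb: "\<forall>Is\<in>set gblocks. \<forall>I\<in>set Is. gates N I"
    "sum_list (map (\<lambda>Is. Suc (length Is)) gblocks) \<le> 28 * k * (k + 1) * L"
    "\<And>A. A \<subseteq> {..<N} \<Longrightarrow> card A = k \<Longrightarrow> L \<le> card (\<Union>Is\<in>set gblocks. path_visits Is A)"
    using path_schedule[OF assms(6-10)] by blast
  let ?P = "g ` {..<N}"
  \<comment> \<open>Indices from \<open>k\<close> on give the empty matching; index \<open>k\<close>
    serves the sets that are already on the path.\<close>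
  define X where "X = (\<lambda>i. if i < k then (\<lambda>v. {v, f (v, i)}) ` R else {})"
  have X: "swap_matching E (X i)" for i
  proof (cases "i < k")
    case True
    have "v \<noteq> f (w, i)" if "v \<in> R" "w \<in> R" for v w
      using f(2)[OF that(2) True] that R by auto
    moreover have "f (v, i) \<noteq> f (w, i)" if "v \<in> R" "w \<in> R" "v \<noteq> w" for v w
      using f(1) that True by (auto simp: inj_on_def)
    ultimately show ?thesis
      using True f(2) unfolding swap_matching_def X_def adjacent_def pairwise_def disjnt_def
      by auto
  qed (auto simp: X_def swap_matching_def)
  define block where "block = (\<lambda>i Is. X i # map (path_round g) Is)"
  \<comment> \<open>Different agent sets need different entries, so every entry is combined with
    every path block. This gives one factor \<open>k + 1\<close> in the length, and undoing gives
    the factor 2.\<close>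
  define blocks where "blocks = concat (map (\<lambda>i. map (block i) gblocks) [0..<Suc k])"
  have set_blocks: "set blocks = {block i Is | i Is. i \<le> k \<and> Is \<in> set gblocks}"
    unfolding blocks_def set_concat set_map set_upt by (force simp: less_Suc_eq_le)
  have valid: "\<forall>Ms\<in>set blocks. \<forall>M\<in>set Ms. swap_matching E M"
    unfolding set_blocks block_def using X gb(1) swap_matching_path_round[OF path] by auto
  have "sum_list (map length blocks) = Suc k * sum_list (map (\<lambda>Is. Suc (length Is)) gblocks)"
  proof -
    have "sum_list (map length (concat (map (\<lambda>i. map (block i) gblocks) is))) =
        length is * sum_list (map (\<lambda>Is. Suc (length Is)) gblocks)" for "is"
      by (induction "is") (auto simp: block_def comp_def)
    from this[of "[0..<Suc k]"] show ?thesis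
      unfolding blocks_def by (simp del: upt_Suc)
  qed
  then have "length (with_undo blocks) = 2 * (Suc k * sum_list (map (\<lambda>Is. Suc (length Is)) gblocks))"
    by (simp only: length_with_undo)
  also have "\<dots> \<le> 2 * (Suc k * (28 * k * (k + 1) * L))"
    using gb(2) by (intro mult_left_mono) auto
  finally have len: "length (with_undo blocks) \<le> 56 * k * (k + 1)\<^sup>2 * L"
    by (simp add: power2_eq_square algebra_simps)
  have "L \<le> card (visits (with_undo blocks) A)" if A: "A \<subseteq> V" "card A = k" for A
  proof -
    have finA: "finite A" using A(1) assms(1) finite_subset by blast
    have "\<exists>i\<le>k. swap_along (X i) ` A \<subseteq> ?P"
    proof (cases "A \<inter> R = {}")
      case True
      then have "swap_along (X k) ` A \<subseteq> ?P"
        using A(1) R by (auto simp: X_def swap_along_fixed)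
      then show ?thesis by blast
    next
      case False
      \<comment> \<open>Otherwise each of the \<open>k\<close> disjoint images would contain a
        vertex of \<open>A\<close>; these would be \<open>k\<close> vertices of \<open>A\<close> on
        the path, although \<open>A\<close> has only \<open>k\<close> elements and one of them is
        off the path.\<close>
      have "\<exists>i<k. \<forall>v\<in>R. f (v, i) \<notin> A"
      proof (rule ccontr)
        assume "\<not> ?thesis"
        then obtain h where h: "\<And>i. i < k \<Longrightarrow> h i \<in> R \<and> f (h i, i) \<in> A"
          by metis
        have "inj_on (\<lambda>i. f (h i, i)) {..<k}"
          using f(1) h by (auto simp: inj_on_def)
        moreover have "(\<lambda>i. f (h i, i)) ` {..<k} \<subseteq> A - R"
          using h f(2) R by auto
        ultimately have "card {..<k} \<le> card (A - R)"
          using finA by (intro card_inj_on_le) auto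
        also have "\<dots> < card A"
          using False finA by (intro psubset_card_mono) auto
        finally show False using A(2) by simp
      qed
      then obtain i where i: "i < k" "\<And>v. v \<in> R \<Longrightarrow> f (v, i) \<notin> A" by blast
      have "swap_along (X i) a \<in> ?P" if "a \<in> A" for a
      proof (cases "a \<in> R")
        case True
        have "{f (a, i), a} \<in> X i"
          using True i(1) by (auto simp: X_def)
        moreover have "f (a, i) \<noteq> a"
          using f(2)[OF True i(1)] True R by auto
        ultimately have "swap_along (X i) a = f (a, i)"
          using swap_along_eqI[OF X] by metis
        then show ?thesis using f(2)[OF True i(1)] by simp
      next
        case False
        then have "a \<notin> \<Union>(X i)"
          using i that by (auto simp: X_def)
        then show ?thesis
          using False that A(1) R by (auto simp: swap_along_fixed)
      qed
      then show ?thesis using i(1) by (intro exI[of _ i]) auto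
    qed
    then obtain i where i: "i \<le> k" "swap_along (X i) ` A \<subseteq> ?P" by blast
    obtain A' where A': "A' \<subseteq> {..<N}" "g ` A' = swap_along (X i) ` A"
      using subset_imageE[OF i(2)] by metis
    have inj_g: "inj_on g {..<N}" using path by (simp add: is_path_def)
    have "inj (swap_along (X i))"
      by (rule inj_on_inverseI[of _ "swap_along (X i)"]) (simp add: swap_along_involution[OF X])
    then have "card (swap_along (X i) ` A) = k"
      using A(2) by (subst card_image) (auto intro: inj_on_subset)
    then have cA': "card A' = k"
      using A' card_image[OF inj_on_subset[OF inj_g A'(1)]] by simp
    have "(`) g ` path_visits Is A' \<subseteq> visits (with_undo blocks) A" if "Is \<in> set gblocks" for Is
    proof -
      have "(`) g ` path_visits Is A' = visits (map (path_round g) Is) (agent_position [X i] ` A)"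
        using visits_path[OF path _ A'(1), of Is] gb(1) that A'(2) by (simp add: agent_position_def)
      also have "\<dots> \<subseteq> visits ([X i] @ map (path_round g) Is) A"
        by (rule visits_append2)
      also have "\<dots> \<subseteq> visits (with_undo blocks) A"
        by (rule visits_with_undo[OF valid]) (use i(1) that in \<open>auto simp: set_blocks block_def\<close>)
      finally show ?thesis .
    qed
    then have sub: "(`) g ` (\<Union>Is\<in>set gblocks. path_visits Is A') \<subseteq> visits (with_undo blocks) A"
      by blast
    have "L \<le> card (\<Union>Is\<in>set gblocks. path_visits Is A')"
      by (rule gb(3)[OF A'(1) cA'])
    also have "\<dots> = card ((`) g ` (\<Union>Is\<in>set gblocks. path_visits Is A'))"
    proof (rule card_image[symmetric], rule inj_on_subset[OF inj_on_image_Pow[OF inj_g]])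
      show "(\<Union>Is\<in>set gblocks. path_visits Is A') \<subseteq> Pow {..<N}"
        using path_visits_subset(1)[OF _ _ A'(1)] gb(1) by blast
    qed
    also have "\<dots> \<le> card (visits (with_undo blocks) A)"
      by (intro card_mono finite_visits sub)
    finally show ?thesis .
  qed
  then show ?thesis
    using valid len by (intro exI[of _ "with_undo blocks"]) (auto simp: set_with_undo)
qed

section \<open>Long paths and matchings\<close>

text \<open>
  Depth-first search: \<open>D\<close> holds the abandoned vertices, \<open>xs\<close> is the current search path. No
  edge joins \<open>D\<close> to the unvisited vertices, and at some moment both sets have the same size.
\<close>

lemma long_path_exists:
  assumes "finite V" "m > 0"
    and hole: "\<And>X Y. X \<subseteq> V \<Longrightarrow> Y \<subseteq> V \<Longrightarrow> X \<inter> Y = {} \<Longrightarrow> card X = m \<Longrightarrow> card Y = m \<Longrightarrow>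
      \<exists>x\<in>X. \<exists>y\<in>Y. adjacent E x y"
  obtains xs where "distinct xs" "set xs \<subseteq> V" "successively (adjacent E) xs" "card V \<le> length xs + 2 * m"
proof -
  define U where "U = (\<lambda>(D, xs). V - D - set xs)"
  define state where "state = (\<lambda>(D, xs). D \<subseteq> V \<and> set xs \<subseteq> V \<and> distinct xs \<and> D \<inter> set xs = {} \<and>
    successively (adjacent E) xs \<and> (\<forall>x\<in>D. \<forall>y\<in>U (D, xs). \<not> adjacent E x y) \<and> card D \<le> card (U (D, xs)))"
  \<comment> \<open>Both moves of the search raise this rank by one: visiting adds a vertex of
    weight 1, abandoning turns weight 1 into 2. A state of greatest rank replaces the run of the
    search, since no move from it preserves the invariant.\<close>
  define rank where "rank = (\<lambda>(D :: 'a set, xs :: 'a list). 2 * card D + length xs)"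
  have "rank s \<le> 3 * card V" if "state s" for s
  proof -
    obtain D xs where s: "s = (D, xs)" by (cases s)
    have "card D \<le> card V" "length xs \<le> card V"
      using that assms(1) unfolding s state_def by (auto intro: card_mono simp: distinct_card[symmetric])
    then show ?thesis unfolding s rank_def by simp
  qed
  moreover have "state ({}, [])" by (simp add: state_def)
  ultimately obtain s where s: "state s" "\<And>s'. state s' \<Longrightarrow> rank s' \<le> rank s"
    using ex_has_greatest_nat[of state "({}, [])" rank "Suc (3 * card V)"] by (metis le_imp_less_Suc)
  obtain D xs where sD: "s = (D, xs)" by (cases s)
  note st = s(1)[unfolded sD state_def prod.case]
  have finU: "finite (U (D, xs))" and finD: "finite D"
    using assms(1) st by (auto simp: U_def intro: finite_subset)
  have "card D = card (U (D, xs))"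
  proof (rule ccontr)
    assume "card D \<noteq> card (U (D, xs))"
    then have less: "card D < card (U (D, xs))" using st by simp
    then have ne: "U (D, xs) \<noteq> {}" by auto
    have push: False if y: "y \<in> U (D, xs)" "xs = [] \<or> adjacent E y (hd xs)" for y
    proof -
      have U': "U (D, y # xs) = U (D, xs) - {y}" by (auto simp: U_def)
      have "card D \<le> card (U (D, y # xs))"
        unfolding U' using less finU y(1) by (simp add: card_Diff_singleton)
      then have "state (D, y # xs)"
        using st y unfolding state_def prod.case U' by (cases xs) (auto simp: U_def)
      from s(2)[OF this] show False by (simp add: sD rank_def)
    qed
    show False
    proof (cases xs)
      case Nil
      then show ?thesis using push ne by blast
    next
      case (Cons x ys)
      have U': "U (insert x D, ys) = U (D, xs)" by (auto simp: U_def Cons)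
      have x: "x \<in> V" "x \<notin> D" "x \<notin> set ys" using st Cons by auto
      have "\<forall>y\<in>U (D, xs). \<not> adjacent E x y"
        using push Cons adjacent_commute by fastforce
      moreover have "card (insert x D) \<le> card (U (D, xs))"
        using less x finD by simp
      ultimately have "state (insert x D, ys)"
        using st x unfolding state_def prod.case U' Cons by (cases ys) auto
      from s(2)[OF this] show False
        using x finD by (simp add: sD rank_def Cons)
    qed
  qed
  \<comment> \<open>Otherwise the abandoned and the unvisited vertices, being equally many and
    without adjacency between them, would contradict \<open>hole\<close>.\<close>
  moreover have "card D < m"
  proof (rule ccontr)
    assume "\<not> card D < m"
    then obtain X Y where XY: "X \<subseteq> D" "card X = m" "Y \<subseteq> U (D, xs)" "card Y = m"
      using obtain_subset_with_card_n[of m D] obtain_subset_with_card_n[of m "U (D, xs)"] calculation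
      by (metis not_less)
    have "D \<subseteq> V" "U (D, xs) \<subseteq> V" "D \<inter> U (D, xs) = {}"
      using st by (auto simp: U_def)
    then have "X \<subseteq> V" "Y \<subseteq> V" "X \<inter> Y = {}"
      using XY(1,3) by blast+
    from hole[OF this XY(2,4)] show False
      using st XY(1,3) by blast
  qed
  moreover have "card V = card D + card (U (D, xs)) + length xs"
  proof -
    have "card V = card (D \<union> set xs \<union> U (D, xs))"
      using st by (intro arg_cong[of _ _ card]) (auto simp: U_def)
    also have "\<dots> = card (D \<union> set xs) + card (U (D, xs))"
      using finD finU by (intro card_Un_disjoint) (auto simp: U_def)
    also have "card (D \<union> set xs) = card D + card (set xs)"
      using finD st by (intro card_Un_disjoint) auto
    finally show ?thesis using st by (simp add: distinct_card)
  qed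
  ultimately show ?thesis
    using st that[of xs] by simp
qed

text \<open>Induction after Halmos and Vaughan. A nonempty proper subset \<open>S\<close> with
  exactly \<open>card S\<close> neighbours is matched first, and the rest still satisfies the
  condition outside the neighbours of \<open>S\<close>. If there is none, every nonempty proper
  subset has a neighbour to spare, so \<open>x\<close> may take any partner.\<close>

theorem hall_marriage:
  assumes "finite X" "\<forall>x\<in>X. finite (Nb x)" "\<forall>S\<subseteq>X. card S \<le> card (\<Union>(Nb ` S))"
  shows "\<exists>f. inj_on f X \<and> (\<forall>x\<in>X. f x \<in> Nb x)"
  using assms
proof (induction "card X" arbitrary: X Nb rule: less_induct)
  case less
  show ?case
  proof (cases "X = {}")
    case False
    then obtain x where x: "x \<in> X" by blast
    have fin: "finite (\<Union>(Nb ` S))" if "S \<subseteq> X" for S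
      using that less.prems(1,2) finite_subset[OF that] by auto
    show ?thesis
    proof (cases "\<exists>S. S \<subset> X \<and> S \<noteq> {} \<and> card S = card (\<Union>(Nb ` S))")
      case True
      then obtain S where S: "S \<subset> X" "S \<noteq> {}" "card S = card (\<Union>(Nb ` S))" by blast
      have finS: "finite S" using S(1) less.prems(1) finite_subset by blast
      have "\<exists>f. inj_on f S \<and> (\<forall>x\<in>S. f x \<in> Nb x)"
        using less.prems S by (intro less.hyps psubset_card_mono) (auto intro: finite_subset)
      then obtain f where f: "inj_on f S" "\<forall>x\<in>S. f x \<in> Nb x" by blast
      define Nb' where "Nb' = (\<lambda>x. Nb x - \<Union>(Nb ` S))"
      have "\<exists>h. inj_on h (X - S) \<and> (\<forall>x\<in>X - S. h x \<in> Nb' x)"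
      proof (rule less.hyps)
        show "card (X - S) < card X"
          using S less.prems(1) by (intro psubset_card_mono) auto
        show "\<forall>T\<subseteq>X - S. card T \<le> card (\<Union>(Nb' ` T))"
        proof (intro allI impI)
          fix T assume T: "T \<subseteq> X - S"
          then have finT: "finite T" using less.prems(1) finite_subset by blast
          have "card T + card S = card (T \<union> S)"
            using T finS finT by (subst card_Un_disjoint) auto
          also have "\<dots> \<le> card (\<Union>(Nb ` (T \<union> S)))"
            using less.prems(3) T S(1) by (meson Diff_subset Un_least psubset_imp_subset subset_trans)
          also have "\<Union>(Nb ` (T \<union> S)) = \<Union>(Nb' ` T) \<union> \<Union>(Nb ` S)"
            by (auto simp: Nb'_def)
          also have "card \<dots> \<le> card (\<Union>(Nb' ` T)) + card (\<Union>(Nb ` S))"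
            by (rule card_Un_le)
          finally show "card T \<le> card (\<Union>(Nb' ` T))" using S(3) by simp
        qed
      qed (use less.prems in \<open>auto simp: Nb'_def\<close>)
      then obtain h where h: "inj_on h (X - S)" "\<forall>x\<in>X - S. h x \<in> Nb' x" by blast
      let ?f = "\<lambda>x. if x \<in> S then f x else h x"
      have "f a \<noteq> h b" if "a \<in> S" "b \<in> X - S" for a b
        using that f(2) h(2) by (auto simp: Nb'_def)
      then have "inj_on ?f X"
        using f(1) h(1) by (auto simp: inj_on_def) metis+
      moreover have "\<forall>x\<in>X. ?f x \<in> Nb x"
        using f(2) h(2) by (auto simp: Nb'_def)
      ultimately show ?thesis by blast
    next
      case strict: False
      have "card {x} \<le> card (\<Union>(Nb ` {x}))"
        using less.prems(3)[rule_format, of "{x}"] x by simp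
      then have "Nb x \<noteq> {}" by auto
      then obtain y where y: "y \<in> Nb x" by blast
      have "\<exists>f. inj_on f (X - {x}) \<and> (\<forall>z\<in>X - {x}. f z \<in> Nb z - {y})"
      proof (rule less.hyps)
        show "card (X - {x}) < card X"
          using x less.prems(1) by (intro psubset_card_mono) auto
        show "\<forall>S\<subseteq>X - {x}. card S \<le> card (\<Union>((\<lambda>z. Nb z - {y}) ` S))"
        proof (intro allI impI)
          fix S assume S: "S \<subseteq> X - {x}"
          have eq: "\<Union>((\<lambda>z. Nb z - {y}) ` S) = \<Union>(Nb ` S) - {y}" by auto
          show "card S \<le> card (\<Union>((\<lambda>z. Nb z - {y}) ` S))"
          proof (cases "S = {}")
            case False
            then have "card S \<noteq> card (\<Union>(Nb ` S))" using strict S x by blast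
            moreover have "card S \<le> card (\<Union>(Nb ` S))" using less.prems(3) S by blast
            ultimately show ?thesis
              unfolding eq using diff_card_le_card_Diff[of "{y}" "\<Union>(Nb ` S)"] by simp
          qed simp
        qed
      qed (use less.prems in auto)
      then obtain f where f: "inj_on f (X - {x})" "\<forall>z\<in>X - {x}. f z \<in> Nb z - {y}" by blast
      have "inj_on (f(x := y)) X"
        using f by (auto simp: inj_on_def)
      moreover have "\<forall>z\<in>X. (f(x := y)) z \<in> Nb z"
        using f(2) y by auto
      ultimately show ?thesis by blast
    qed
  qed auto
qed

section \<open>Random hypergraphs\<close>

lemma finite_uniform_edges: "finite (uniform_edges r n)"
  by (rule finite_subset[of _ "Pow {1..n}"]) (auto simp: uniform_edges_def)

lemma set_pmf_random_hypergraph: "E \<in> set_pmf (random_hypergraph r n p) \<Longrightarrow> E \<subseteq> uniform_edges r n"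
  by (auto simp: random_hypergraph_def)

lemma prob_random_hypergraph_avoids:
  assumes "0 \<le> p" "p \<le> 1" "S \<subseteq> uniform_edges r n"
  shows "measure_pmf.prob (random_hypergraph r n p) {E. E \<inter> S = {}} = (1 - p) ^ card S"
proof -
  let ?U = "uniform_edges r n"
  have "measure_pmf.prob (random_hypergraph r n p) {E. E \<inter> S = {}} =
      measure_pmf.prob (Pi_pmf ?U False (\<lambda>_. bernoulli_pmf p))
        (Pi ?U (\<lambda>e. if e \<in> S then {False} else UNIV))"
    using assms(3) unfolding random_hypergraph_def measure_map_pmf
    by (intro arg_cong2[of _ _ _ _ measure] refl) (auto simp: Pi_def)
  also have "\<dots> = (\<Prod>e\<in>?U. measure_pmf.prob (bernoulli_pmf p) (if e \<in> S then {False} else UNIV))"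
    by (rule measure_Pi_pmf_Pi[OF finite_uniform_edges])
  also have "\<dots> = (\<Prod>e\<in>?U. if e \<in> S then 1 - p else 1)"
    using assms by (intro prod.cong) (auto simp: measure_pmf_single)
  also have "\<dots> = (1 - p) ^ card (?U \<inter> S)"
    by (simp add: prod.If_cases finite_uniform_edges)
  also have "?U \<inter> S = S" using assms(3) by blast
  finally show ?thesis .
qed

text \<open>An edge is missing from the union exactly if both independent coins fail:
  \<open>1 - p = (1 - q) * (1 - q')\<close>.\<close>

lemma random_hypergraph_union:
  assumes "0 \<le> q" "q \<le> 1" "0 \<le> q'" "q' \<le> 1" "p = q + (1 - q) * q'"
  shows "random_hypergraph r n p =
    bind_pmf (random_hypergraph r n q) (\<lambda>E. map_pmf ((\<union>) E) (random_hypergraph r n q'))"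
proof -
  let ?U = "uniform_edges r n"
  have p: "0 \<le> p" "p \<le> 1"
  proof -
    show "0 \<le> p" using assms by simp
    have "(1 - q) * q' \<le> 1 - q"
      using assms mult_left_mono[of q' 1 "1 - q"] by simp
    then show "p \<le> 1" using assms by simp
  qed
  have "bernoulli_pmf p = bind_pmf (bernoulli_pmf q) (\<lambda>a. bind_pmf (bernoulli_pmf q') (\<lambda>b. return_pmf (a \<or> b)))"
  proof (rule pmf_eqI)
    fix x show "pmf (bernoulli_pmf p) x =
        pmf (bind_pmf (bernoulli_pmf q) (\<lambda>a. bind_pmf (bernoulli_pmf q') (\<lambda>b. return_pmf (a \<or> b)))) x"
      using assms p by (cases x) (simp_all add: pmf_bind algebra_simps)
  qed
  then have "Pi_pmf ?U False (\<lambda>_. bernoulli_pmf p) =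
      bind_pmf (Pi_pmf ?U False (\<lambda>_. bernoulli_pmf q)) (\<lambda>f.
      bind_pmf (Pi_pmf ?U False (\<lambda>_. bernoulli_pmf q')) (\<lambda>h.
      return_pmf (\<lambda>e. if e \<in> ?U then f e \<or> h e else False)))"
    by (simp add: Pi_pmf_bind[where d'=False] finite_uniform_edges)
  moreover have "{e \<in> ?U. if e \<in> ?U then f e \<or> h e else False} = {e \<in> ?U. f e} \<union> {e \<in> ?U. h e}" for f h
    by auto
  ultimately show ?thesis
    unfolding random_hypergraph_def map_pmf_def by (simp add: bind_assoc_pmf bind_return_pmf)
qed

text \<open>After density \<open>q\<close>, the density still to be exposed is
  \<open>(p - q) / (1 - q)\<close>. The second bound is required for each good first outcome
  separately, so paths, matchings and schedules may be chosen from the edges already seen.\<close>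

lemma sprinkling:
  assumes "0 \<le> q" "q < 1" "q \<le> p" "p \<le> 1" "0 \<le> b"
    and 1: "measure_pmf.prob (random_hypergraph r n q) {E. \<not> good E} \<le> a"
    and 2: "\<And>E. E \<in> set_pmf (random_hypergraph r n q) \<Longrightarrow> good E \<Longrightarrow>
      measure_pmf.prob (random_hypergraph r n ((p - q) / (1 - q))) {E'. \<not> goal (E \<union> E')} \<le> b"
  shows "measure_pmf.prob (random_hypergraph r n p) {E. \<not> goal E} \<le> a + b"
proof -
  define q' where "q' = (p - q) / (1 - q)"
  have q': "0 \<le> q'" "q' \<le> 1" "p = q + (1 - q) * q'"
    using assms(1-4) by (auto simp: q'_def field_simps)
  let ?M = "random_hypergraph r n q" and ?M' = "random_hypergraph r n q'"
  have union: "random_hypergraph r n p = bind_pmf ?M (\<lambda>E. map_pmf ((\<union>) E) ?M')"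
    using assms(1,2) q' by (intro random_hypergraph_union) auto
  have "emeasure (random_hypergraph r n p) {E. \<not> goal E} =
      (\<integral>\<^sup>+E. emeasure ?M' {E'. \<not> goal (E \<union> E')} \<partial>?M)"
    unfolding union by (simp add: vimage_def)
  also have "\<dots> \<le> (\<integral>\<^sup>+E. indicator {E. \<not> good E} E + ennreal b \<partial>?M)"
  proof (rule nn_integral_mono_AE, rule AE_pmfI)
    fix E assume E: "E \<in> set_pmf ?M"
    show "emeasure ?M' {E'. \<not> goal (E \<union> E')} \<le> indicator {E. \<not> good E} E + ennreal b"
    proof (cases "good E")
      case True
      then show ?thesis
        using 2[OF E True] by (simp add: measure_pmf.emeasure_eq_measure q'_def ennreal_leI)
    next
      case False
      have "emeasure ?M' {E'. \<not> goal (E \<union> E')} \<le> 1"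
        by (rule measure_pmf.emeasure_le_1)
      also have "1 \<le> indicator {E. \<not> good E} E + ennreal b"
        using False by simp
      finally show ?thesis .
    qed
  qed
  also have "\<dots> = emeasure ?M {E. \<not> good E} + ennreal b"
    by (subst nn_integral_add) (auto simp: measure_pmf.emeasure_space_1)
  also have "\<dots> \<le> ennreal a + ennreal b"
    using 1 by (intro add_right_mono) (simp add: measure_pmf.emeasure_eq_measure ennreal_leI)
  also have "\<dots> = ennreal (a + b)"
    using assms(5) order.trans[OF measure_nonneg 1] by simp
  finally show ?thesis
    using assms(5) order.trans[OF measure_nonneg 1]
    by (simp add: measure_pmf.emeasure_eq_measure del: ennreal_plus)
qed

section \<open>Counting and missing the edges that contain given sets\<close>

lemma card_supersets:
  assumes "B \<subseteq> {1..n}" "card B = j" "j \<le> r"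
  shows "card {e \<in> uniform_edges r n. B \<subseteq> e} = (n - j) choose (r - j)"
proof -
  have finB: "finite B" using assms(1) finite_subset by blast
  have "bij_betw (\<lambda>e. e - B) {e \<in> uniform_edges r n. B \<subseteq> e} {T. T \<subseteq> {1..n} - B \<and> card T = r - j}"
  proof (rule bij_betwI[of _ _ _ "\<lambda>T. T \<union> B"])
    show "(\<lambda>e. e - B) \<in> {e \<in> uniform_edges r n. B \<subseteq> e} \<rightarrow> {T. T \<subseteq> {1..n} - B \<and> card T = r - j}"
      using assms finB by (auto simp: uniform_edges_def card_Diff_subset)
    show "(\<lambda>T. T \<union> B) \<in> {T. T \<subseteq> {1..n} - B \<and> card T = r - j} \<rightarrow> {e \<in> uniform_edges r n. B \<subseteq> e}"
    proof
      fix T assume T: "T \<in> {T. T \<subseteq> {1..n} - B \<and> card T = r - j}"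
      then have "finite T" by (auto intro: finite_subset)
      then have "card (T \<union> B) = r"
        using T finB assms by (subst card_Un_disjoint) auto
      then show "T \<union> B \<in> {e \<in> uniform_edges r n. B \<subseteq> e}"
        using T assms(1) by (auto simp: uniform_edges_def)
    qed
  qed auto
  from bij_betw_same_card[OF this] show ?thesis
    using n_subsets[of "{1..n} - B" "r - j"] assms finB by (simp add: card_Diff_subset)
qed

text \<open>Double counting of the pairs \<open>B \<subseteq> e\<close> with
  \<open>B \<in> F\<close>: every \<open>B\<close> lies in \<open>(n - j) choose (r - j)\<close>
  possible edges, and every edge has only \<open>r choose j\<close> subsets of size
  \<open>j\<close>.\<close>

lemma card_hitting_edges:
  assumes "finite F" "\<And>B. B \<in> F \<Longrightarrow> B \<subseteq> {1..n} \<and> card B = j" "j \<le> r"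
  shows "card F * ((n - j) choose (r - j)) \<le> card {e \<in> uniform_edges r n. \<exists>B\<in>F. B \<subseteq> e} * (r choose j)"
proof -
  let ?S = "{e \<in> uniform_edges r n. \<exists>B\<in>F. B \<subseteq> e}"
  have finS: "finite ?S" using finite_uniform_edges by simp
  have fine: "finite e" if "e \<in> ?S" for e
    by (rule finite_subset[of _ "{1..n}"]) (use that in \<open>auto simp: uniform_edges_def\<close>)
  then have finB: "\<forall>e\<in>?S. finite {B. B \<subseteq> e \<and> card B = j}"
    by auto
  have "card F * ((n - j) choose (r - j)) = (\<Sum>B\<in>F. card {e \<in> uniform_edges r n. B \<subseteq> e})"
    using assms card_supersets by simp
  also have "\<dots> = card (SIGMA B:F. {e \<in> uniform_edges r n. B \<subseteq> e})"
    using assms(1) finite_uniform_edges by (subst card_SigmaI) auto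
  also have "\<dots> \<le> card (SIGMA e:?S. {B. B \<subseteq> e \<and> card B = j})"
  proof (rule card_inj_on_le[of prod.swap])
    show "finite (SIGMA e:?S. {B. B \<subseteq> e \<and> card B = j})"
      using finS finB by (intro finite_SigmaI) auto
    show "prod.swap ` (SIGMA B:F. {e \<in> uniform_edges r n. B \<subseteq> e}) \<subseteq> (SIGMA e:?S. {B. B \<subseteq> e \<and> card B = j})"
    proof clarsimp
      fix B e assume "B \<in> F" "e \<in> uniform_edges r n" "B \<subseteq> e"
      then show "(\<exists>B\<in>F. B \<subseteq> e) \<and> card B = j"
        using assms(2)[of B] by blast
    qed
  qed simp
  also have "\<dots> = (\<Sum>e\<in>?S. card {B. B \<subseteq> e \<and> card B = j})"
    using finS finB by (subst card_SigmaI) auto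
  also have "\<dots> = (\<Sum>e\<in>?S. r choose j)"
  proof (intro sum.cong refl)
    fix e assume "e \<in> ?S"
    then show "card {B. B \<subseteq> e \<and> card B = j} = r choose j"
      using n_subsets[OF fine] by (auto simp: uniform_edges_def)
  qed
  finally show ?thesis by simp
qed

text \<open>The constant collects crude estimates: \<open>2 * r \<le> n\<close> gives
  \<open>(n - j) choose (r - j) \<ge> (n / (2 * r)) ^ (r - j)\<close>, and
  \<open>r choose j \<le> 2 ^ r\<close>, so the loss is at most
  \<open>(2 * r) ^ r * 2 ^ r = (4 * r) ^ r\<close>.\<close>

lemma card_hitting_edges_ge:
  assumes "finite F" "\<And>B. B \<in> F \<Longrightarrow> B \<subseteq> {1..n} \<and> card B = j" "j \<le> r" "1 \<le> r" "2 * r \<le> n"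
  shows "real (card F) * real n ^ (r - j) / (4 * real r) ^ r \<le> card {e \<in> uniform_edges r n. \<exists>B\<in>F. B \<subseteq> e}"
    (is "_ \<le> real (card ?S)")
proof -
  have "(real n / (2 * real r)) ^ (r - j) \<le> real ((n - j) choose (r - j))"
  proof (cases "r = j")
    case False
    have "real n * real (r - j) \<le> real n * real r"
      by (intro mult_left_mono) auto
    also have "\<dots> \<le> real (n - j) * (2 * real r)"
    proof -
      have "n \<le> 2 * (n - j)" using assms by simp
      then have "real n \<le> 2 * real (n - j)" by linarith
      then have "real n * real r \<le> (2 * real (n - j)) * real r" by (intro mult_right_mono) auto
      then show ?thesis by (simp add: mult_ac)
    qed
    finally have "real n / (2 * real r) \<le> real (n - j) / real (r - j)"
      using False assms by (simp add: field_simps)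
    then have "(real n / (2 * real r)) ^ (r - j) \<le> (real (n - j) / real (r - j)) ^ (r - j)"
      by (intro power_mono) auto
    also have "\<dots> \<le> real ((n - j) choose (r - j))"
      using assms by (intro binomial_ge_n_over_k_pow_k) auto
    finally show ?thesis .
  qed simp
  moreover have "real n ^ (r - j) / (2 * real r) ^ r \<le> (real n / (2 * real r)) ^ (r - j)"
    unfolding power_divide using assms by (intro divide_left_mono power_increasing) auto
  ultimately have "real n ^ (r - j) / (2 * real r) ^ r \<le> real ((n - j) choose (r - j))"
    by linarith
  then have "real (card F) * (real n ^ (r - j) / (2 * real r) ^ r) \<le> real (card F * ((n - j) choose (r - j)))"
    unfolding of_nat_mult by (intro mult_left_mono) auto
  also have "\<dots> \<le> real (card ?S * (r choose j))"
    using card_hitting_edges[OF assms(1-3)] by (simp only: of_nat_le_iff)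
  also have "\<dots> \<le> real (card ?S) * 2 ^ r"
    unfolding of_nat_mult using binomial_le_pow2[of r j]
  proof (intro mult_left_mono)
    have "real (r choose j) \<le> real (2 ^ r)"
      by (simp only: of_nat_le_iff binomial_le_pow2)
    then show "real (r choose j) \<le> 2 ^ r" by simp
  qed simp
  finally have "real (card F) * (real n ^ (r - j) / (2 * real r) ^ r) / 2 ^ r \<le> real (card ?S)"
    by (subst pos_divide_le_eq) simp_all
  moreover have "(4 * real r) ^ r = (2 * real r) ^ r * 2 ^ r"
    unfolding power_mult_distrib[symmetric] by simp
  ultimately show ?thesis by (simp only: times_divide_eq_right divide_divide_eq_left)
qed

text \<open>Independence and \<open>1 - p \<le> exp (- p)\<close>. The case \<open>j = 2\<close>
  serves adjacency, the case \<open>j = k\<close> acquaintance.\<close>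

lemma prob_no_edge_contains:
  assumes "0 \<le> p" "p \<le> 1" "\<And>B. B \<in> F \<Longrightarrow> B \<subseteq> {1..n} \<and> card B = j" "j \<le> r" "1 \<le> r" "2 * r \<le> n"
    and "x \<le> real (card F)"
  shows "measure_pmf.prob (random_hypergraph r n p) {E. \<not> (\<exists>B\<in>F. \<exists>e\<in>E. B \<subseteq> e)} \<le>
    exp (- (p * x * real n ^ (r - j) / (4 * real r) ^ r))"
proof -
  let ?S = "{e \<in> uniform_edges r n. \<exists>B\<in>F. B \<subseteq> e}"
  have finF: "finite F"
    by (rule finite_subset[of _ "Pow {1..n}"]) (use assms(3) in auto)
  have "measure_pmf.prob (random_hypergraph r n p) {E. \<not> (\<exists>B\<in>F. \<exists>e\<in>E. B \<subseteq> e)} \<le>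
      measure_pmf.prob (random_hypergraph r n p) {E. E \<inter> ?S = {}}"
    by (intro measure_pmf.finite_measure_mono) auto
  also have "\<dots> = (1 - p) ^ card ?S"
    by (rule prob_random_hypergraph_avoids[OF assms(1,2)]) auto
  also have "\<dots> \<le> exp (- p) ^ card ?S"
    using assms(2) exp_ge_add_one_self[of "- p"] by (intro power_mono) auto
  also have "\<dots> = exp (- (p * real (card ?S)))"
    by (simp add: exp_of_nat_mult[symmetric] mult.commute)
  also have "\<dots> \<le> exp (- (p * x * real n ^ (r - j) / (4 * real r) ^ r))"
  proof -
    have "p * (x * real n ^ (r - j) / (4 * real r) ^ r) \<le> p * (real (card F) * real n ^ (r - j) / (4 * real r) ^ r)"
      using assms(1,7) by (intro mult_left_mono divide_right_mono mult_right_mono) auto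
    also have "\<dots> \<le> p * real (card ?S)"
      using card_hitting_edges_ge[OF finF assms(3-6)] assms(1) by (intro mult_left_mono) auto
    finally show ?thesis by (simp add: mult.assoc)
  qed
  finally show ?thesis .
qed

lemma prob_union_bound:
  assumes "finite I" "\<And>i. i \<in> I \<Longrightarrow> measure_pmf.prob M {x. Q i x} \<le> b" "real (card I) \<le> c" "0 \<le> b"
  shows "measure_pmf.prob M {x. \<exists>i\<in>I. Q i x} \<le> c * b"
proof -
  have "{x. \<exists>i\<in>I. Q i x} = (\<Union>i\<in>I. {x. Q i x})" by auto
  then have "measure_pmf.prob M {x. \<exists>i\<in>I. Q i x} \<le> (\<Sum>i\<in>I. measure_pmf.prob M {x. Q i x})"
    using assms(1) by (simp add: measure_pmf.finite_measure_subadditive_finite)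
  also have "\<dots> \<le> real (card I) * b"
    using assms(2) sum_bounded_above by metis
  also have "\<dots> \<le> c * b"
    using assms(3,4) by (intro mult_right_mono) auto
  finally show ?thesis .
qed

section \<open>Failure probabilities of the exposures\<close>

lemma card_cross_pairs:
  assumes "finite X" "finite Y" "X \<inter> Y = {}"
  shows "card ((\<lambda>(x, y). {x, y}) ` (X \<times> Y)) = card X * card Y"
proof -
  have "inj_on (\<lambda>(x, y). {x, y}) (X \<times> Y)"
    using assms(3) by (auto simp: inj_on_def doubleton_eq_iff)
  then show ?thesis using assms by (simp add: card_image card_cartesian_product)
qed

lemma prob_not_adjacent:
  assumes "0 \<le> p" "p \<le> 1" "2 \<le> r" "2 * r \<le> n" "X \<subseteq> {1..n}" "Y \<subseteq> {1..n}" "X \<inter> Y = {}"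
    and "x \<le> real (card X * card Y)"
  shows "measure_pmf.prob (random_hypergraph r n p) {E. \<not> (\<exists>x\<in>X. \<exists>y\<in>Y. adjacent E x y)} \<le>
    exp (- (p * x * real n ^ (r - 2) / (4 * real r) ^ r))"
proof -
  let ?F = "(\<lambda>(x, y). {x, y}) ` (X \<times> Y)"
  have fin: "finite X" "finite Y" using assms(5,6) finite_subset by blast+
  have eq: "{E. \<not> (\<exists>x\<in>X. \<exists>y\<in>Y. adjacent E x y)} = {E. \<not> (\<exists>B\<in>?F. \<exists>e\<in>E. B \<subseteq> e)}"
    by (auto simp: adjacent_def)
  have "card {a, b} = 2" if "a \<in> X" "b \<in> Y" for a b
  proof -
    have "a \<noteq> b" using that assms(7) by auto
    then show ?thesis by simp
  qed
  then have F: "B \<subseteq> {1..n} \<and> card B = 2" if "B \<in> ?F" for B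
    using that assms(5,6) by auto
  have "x \<le> real (card ?F)"
    using assms(8) by (simp only: card_cross_pairs[OF fin assms(7)])
  then show ?thesis
    unfolding eq using assms by (intro prob_no_edge_contains F) auto
qed


text \<open>The crude count of \<open>4 ^ n\<close> pairs is good enough: with \<open>m\<close>
  linear in \<open>n\<close>, the exponent is of order
  \<open>p n^r = \<omega> n log n\<close>.\<close>

lemma prob_hole:
  assumes "0 \<le> p" "p \<le> 1" "2 \<le> r" "2 * r \<le> n"
  shows "measure_pmf.prob (random_hypergraph r n p)
      {E. \<not> (\<forall>X Y. X \<subseteq> {1..n} \<and> Y \<subseteq> {1..n} \<and> X \<inter> Y = {} \<and> card X = m \<and> card Y = m \<longrightarrow>
        (\<exists>x\<in>X. \<exists>y\<in>Y. adjacent E x y))}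
    \<le> 4 ^ n * exp (- (p * real m ^ 2 * real n ^ (r - 2) / (4 * real r) ^ r))"
proof -
  define I where "I = {(X, Y). X \<subseteq> {1..n} \<and> Y \<subseteq> {1..n} \<and> X \<inter> Y = {} \<and> card X = m \<and> card Y = m}"
  have sub: "I \<subseteq> Pow {1..n} \<times> Pow {1..n}" by (auto simp: I_def)
  then have fin: "finite I" by (rule finite_subset) simp
  have "card I \<le> card (Pow {1..n} \<times> Pow {1..n})" by (rule card_mono[OF _ sub]) simp
  also have "\<dots> = 4 ^ n"
    by (simp add: card_cartesian_product card_Pow flip: power_mult_distrib)
  finally have card: "real (card I) \<le> 4 ^ n"
    by (metis of_nat_le_iff of_nat_numeral of_nat_power)
  have "measure_pmf.prob (random_hypergraph r n p) {E. \<exists>i\<in>I. \<not> (\<exists>x\<in>fst i. \<exists>y\<in>snd i. adjacent E x y)}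
      \<le> 4 ^ n * exp (- (p * real m ^ 2 * real n ^ (r - 2) / (4 * real r) ^ r))"
  proof (rule prob_union_bound[OF fin _ card])
    fix i assume "i \<in> I"
    then show "measure_pmf.prob (random_hypergraph r n p) {E. \<not> (\<exists>x\<in>fst i. \<exists>y\<in>snd i. adjacent E x y)}
        \<le> exp (- (p * real m ^ 2 * real n ^ (r - 2) / (4 * real r) ^ r))"
      using assms by (intro prob_not_adjacent) (auto simp: I_def power2_eq_square)
  qed simp
  moreover have "{E. \<exists>i\<in>I. \<not> (\<exists>x\<in>fst i. \<exists>y\<in>snd i. adjacent E x y)} =
    {E. \<not> (\<forall>X Y. X \<subseteq> {1..n} \<and> Y \<subseteq> {1..n} \<and> X \<inter> Y = {} \<and> card X = m \<and> card Y = m \<longrightarrow>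
        (\<exists>x\<in>X. \<exists>y\<in>Y. adjacent E x y))}"
    by (auto simp: I_def)
  ultimately show ?thesis by simp
qed

text \<open>
  If fewer than \<open>k * card S\<close> vertices of \<open>P\<close> are adjacent to \<open>S\<close>, put them into a set \<open>T\<close> of size
  \<open>k * card S\<close>; then no vertex of \<open>P - T\<close> is adjacent to \<open>S\<close>.
\<close>

lemma prob_small_neighbourhood:
  fixes p x :: real
  assumes "0 \<le> p" "p \<le> 1" "2 \<le> r" "2 * r \<le> n" "R \<subseteq> {1..n}" "P \<subseteq> {1..n}" "R \<inter> P = {}"
    and "k * card R \<le> card P" "x \<le> real (card P) - real (k * card R)" "0 \<le> x"
  defines "w \<equiv> real n ^ (k + 1) * exp (- (p * x * real n ^ (r - 2) / (4 * real r) ^ r))"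
  assumes "w \<le> 1"
  shows "measure_pmf.prob (random_hypergraph r n p)
      {E. \<not> (\<forall>S\<subseteq>R. k * card S \<le> card {u\<in>P. \<exists>v\<in>S. adjacent E v u})} \<le> real n * w"
proof -
  let ?M = "random_hypergraph r n p"
  have fin: "finite R" "finite P" using assms(5,6) finite_subset by blast+
  have cRP: "card R \<le> n" "card P \<le> n"
    using card_mono[OF _ assms(5)] card_mono[OF _ assms(6)] by simp_all
  define I where "I = (\<lambda>s. {S. S \<subseteq> R \<and> card S = s} \<times> {T. T \<subseteq> P \<and> card T = k * s})"
  define Q where "Q = (\<lambda>s E. \<exists>i\<in>I s. \<not> (\<exists>v\<in>fst i. \<exists>u\<in>P - snd i. adjacent E v u))"
  have bound: "measure_pmf.prob ?M {E. Q s E} \<le> w" if s: "s \<in> {1..card R}" for s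
  proof -
    have ks: "k * s \<le> k * card R" using s by simp
    have "card (I s) = (card R choose s) * (card P choose (k * s))"
      unfolding I_def using fin by (simp add: card_cartesian_product n_subsets)
    also have "\<dots> \<le> card R ^ s * card P ^ (k * s)"
      using s order.trans[OF ks assms(8)] by (intro mult_mono binomial_le_pow) auto
    also have "\<dots> \<le> n ^ s * n ^ (k * s)"
      using cRP by (intro mult_mono power_mono) auto
    also have "\<dots> = (n ^ (k + 1)) ^ s"
      by (simp add: power_mult power_mult_distrib)
    finally have cardI: "real (card (I s)) \<le> (real n ^ (k + 1)) ^ s"
      by (metis of_nat_le_iff of_nat_power)
    have "measure_pmf.prob ?M {E. Q s E} \<le>
        (real n ^ (k + 1)) ^ s * exp (- (p * (real s * x) * real n ^ (r - 2) / (4 * real r) ^ r))"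
      unfolding Q_def
    proof (rule prob_union_bound[OF _ _ cardI])
      show "finite (I s)" using fin by (simp add: I_def)
      fix i assume "i \<in> I s"
      then obtain S T where i: "i = (S, T)" "S \<subseteq> R" "card S = s" "T \<subseteq> P" "card T = k * s"
        by (auto simp: I_def)
      have "card (P - T) = card P - k * s"
        using i fin by (simp add: card_Diff_subset finite_subset)
      moreover have "x \<le> real (card P - k * s)"
        using assms(8,9) ks by linarith
      ultimately have "real s * x \<le> real (card S * card (P - T))"
        unfolding of_nat_mult i(3) by (intro mult_left_mono) auto
      then show "measure_pmf.prob ?M {E. \<not> (\<exists>v\<in>fst i. \<exists>u\<in>P - snd i. adjacent E v u)} \<le>
          exp (- (p * (real s * x) * real n ^ (r - 2) / (4 * real r) ^ r))"
        using assms i by (intro prob_not_adjacent) auto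
    qed simp
    \<comment> \<open>The number of pairs and the failure probability are both bounded by
      \<open>s\<close>-th powers, so each size \<open>s \<ge> 1\<close> contributes at most
      \<open>w ^ s \<le> w\<close>.\<close>
    also have "\<dots> = w ^ s"
      unfolding w_def power_mult_distrib by (simp add: exp_of_nat_mult[symmetric] mult_ac)
    also have "\<dots> \<le> w"
      using power_decreasing[of 1 s w] s assms(12) by (simp add: w_def)
    finally show ?thesis .
  qed
  have "{E. \<not> (\<forall>S\<subseteq>R. k * card S \<le> card {u\<in>P. \<exists>v\<in>S. adjacent E v u})} \<subseteq> {E. \<exists>s\<in>{1..card R}. Q s E}"
  proof
    fix E assume "E \<in> {E. \<not> (\<forall>S\<subseteq>R. k * card S \<le> card {u\<in>P. \<exists>v\<in>S. adjacent E v u})}"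
    then obtain S where S: "S \<subseteq> R" "card {u\<in>P. \<exists>v\<in>S. adjacent E v u} < k * card S"
      by (auto simp: not_le)
    have cS: "card S \<le> card R" using S(1) fin by (intro card_mono) auto
    have "k * card S \<le> card P"
      using mult_le_mono2[OF cS, of k] assms(8) by linarith
    then obtain T where T: "{u\<in>P. \<exists>v\<in>S. adjacent E v u} \<subseteq> T" "T \<subseteq> P" "card T = k * card S"
      using exists_subset_between[of "{u\<in>P. \<exists>v\<in>S. adjacent E v u}" "k * card S" P] S(2) fin by auto
    have "(S, T) \<in> I (card S)" using S(1) T by (auto simp: I_def)
    moreover have "\<not> (\<exists>v\<in>S. \<exists>u\<in>P - T. adjacent E v u)" using T(1) by blast
    ultimately have "Q (card S) E" unfolding Q_def by force
    moreover have "1 \<le> card S" using S(2) by (cases "card S") auto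
    ultimately show "E \<in> {E. \<exists>s\<in>{1..card R}. Q s E}" using cS by auto
  qed
  then have "measure_pmf.prob ?M {E. \<not> (\<forall>S\<subseteq>R. k * card S \<le> card {u\<in>P. \<exists>v\<in>S. adjacent E v u})} \<le>
      measure_pmf.prob ?M {E. \<exists>s\<in>{1..card R}. Q s E}"
    by (intro measure_pmf.finite_measure_mono) auto
  also have "\<dots> \<le> real n * w"
    by (rule prob_union_bound[OF _ bound]) (use cRP in \<open>auto simp: w_def\<close>)
  finally show ?thesis .
qed

text \<open>Hall's theorem for \<open>k\<close> copies of every \<open>v\<close>, all with the
  neighbourhood of \<open>v\<close>: a set of copies has at most \<open>k\<close> times as many
  elements as there are vertices underlying it.\<close>

lemma matchings_exist:
  assumes "finite R" "finite P" "\<And>S. S \<subseteq> R \<Longrightarrow> k * card S \<le> card {u\<in>P. \<exists>v\<in>S. adjacent E v u}"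
  obtains f where "inj_on f (R \<times> {..<k})" "\<And>v i. v \<in> R \<Longrightarrow> i < k \<Longrightarrow> f (v, i) \<in> P \<and> adjacent E v (f (v, i))"
proof -
  define Nb where "Nb = (\<lambda>(v, i :: nat). {u\<in>P. adjacent E v u})"
  have "\<forall>S\<subseteq>R \<times> {..<k}. card S \<le> card (\<Union>(Nb ` S))"
  proof (intro allI impI)
    fix S assume S: "S \<subseteq> R \<times> {..<k}"
    then have "S \<subseteq> fst ` S \<times> {..<k}" by force
    then have "card S \<le> card (fst ` S \<times> {..<k})"
    proof (rule card_mono[rotated])
      have "fst ` S \<subseteq> R" using S by auto
      then show "finite (fst ` S \<times> {..<k})"
        using assms(1) by (intro finite_cartesian_product) (auto dest: finite_subset)
    qed
    also have "\<dots> = k * card (fst ` S)" by (simp add: card_cartesian_product mult.commute)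
    also have "\<dots> \<le> card {u\<in>P. \<exists>v\<in>fst ` S. adjacent E v u}"
      using S by (intro assms(3)) auto
    also have "{u\<in>P. \<exists>v\<in>fst ` S. adjacent E v u} = \<Union>(Nb ` S)"
      by (force simp: Nb_def)
    finally show "card S \<le> card (\<Union>(Nb ` S))" .
  qed
  then obtain f where "inj_on f (R \<times> {..<k})" "\<forall>x\<in>R \<times> {..<k}. f x \<in> Nb x"
    using hall_marriage[of "R \<times> {..<k}" Nb] assms(1,2) by (auto simp: Nb_def)
  then show ?thesis
    using that[of f] by (auto simp: Nb_def)
qed

text \<open>\<open>Ms\<close> swaps only inside edges of \<open>E\<close>, so the visited sets do
  not depend on the fresh edges \<open>E'\<close>; these only have to contain one visited set for
  each of the at most \<open>n ^ k\<close> agent sets.\<close>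

lemma prob_unacquainted:
  assumes "0 \<le> p" "p \<le> 1" "k \<le> r" "1 \<le> r" "2 * r \<le> n"
    and "E \<subseteq> uniform_edges r n" "\<forall>M\<in>set Ms. swap_matching E M"
    and "\<And>A. A \<subseteq> {1..n} \<Longrightarrow> card A = k \<Longrightarrow> L \<le> card (visits Ms A)"
  shows "measure_pmf.prob (random_hypergraph r n p) {E'. \<not> acquaintance_strategy k {1..n} (E \<union> E') Ms}
    \<le> real n ^ k * exp (- (p * real L * real n ^ (r - k) / (4 * real r) ^ r))"
proof -
  let ?M = "random_hypergraph r n p"
  let ?I = "{A. A \<subseteq> {1..n} \<and> card A = k}"
  have E: "\<Union>E \<subseteq> {1..n}"
    using assms(6) by (auto simp: uniform_edges_def)
  have "card ?I = n choose k" by (simp add: n_subsets)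
  also have "\<dots> \<le> n ^ k"
    using assms(3,5) by (intro binomial_le_pow) auto
  finally have cardI: "real (card ?I) \<le> real n ^ k"
    by (metis of_nat_le_iff of_nat_power)
  have "swap_matching (E \<union> E') M" if "swap_matching E M" for M E'
    using that unfolding swap_matching_def by blast
  then have "{E'. \<not> acquaintance_strategy k {1..n} (E \<union> E') Ms} \<subseteq>
      {E'. \<exists>A\<in>?I. \<not> (\<exists>B\<in>visits Ms A. \<exists>e\<in>E'. B \<subseteq> e)}"
    using assms(7) unfolding acquaintance_strategy_def acquainted_iff_visits by blast
  then have "measure_pmf.prob ?M {E'. \<not> acquaintance_strategy k {1..n} (E \<union> E') Ms} \<le>
      measure_pmf.prob ?M {E'. \<exists>A\<in>?I. \<not> (\<exists>B\<in>visits Ms A. \<exists>e\<in>E'. B \<subseteq> e)}"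
    by (intro measure_pmf.finite_measure_mono) auto
  also have "\<dots> \<le> real n ^ k * exp (- (p * real L * real n ^ (r - k) / (4 * real r) ^ r))"
  proof (rule prob_union_bound[OF _ _ cardI])
    fix A assume A: "A \<in> ?I"
    show "measure_pmf.prob ?M {E'. \<not> (\<exists>B\<in>visits Ms A. \<exists>e\<in>E'. B \<subseteq> e)} \<le>
        exp (- (p * real L * real n ^ (r - k) / (4 * real r) ^ r))"
    proof (rule prob_no_edge_contains)
      show "B \<subseteq> {1..n} \<and> card B = k" if "B \<in> visits Ms A" for B
        using visits_subset[OF that assms(7) E] A by auto
      show "real L \<le> real (card (visits Ms A))"
        using assms(8) A by simp
    qed (use assms in auto)
  qed auto
  finally show ?thesis .
qed

section \<open>Combining the exposures\<close>

lemma le_divide_one: "(a :: real) \<ge> 0 \<Longrightarrow> 0 < d \<Longrightarrow> d \<le> 1 \<Longrightarrow> a \<le> a / d"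
  by (simp add: le_divide_eq mult_left_le)

lemma adjacent_mono: "E \<subseteq> E' \<Longrightarrow> adjacent E u v \<Longrightarrow> adjacent E' u v"
  by (auto simp: adjacent_def)

theorem prob_slow_le:
  fixes p :: real
  assumes "2 \<le> k" "k \<le> r" "0 \<le> p" "p \<le> 1"
    and n: "2 * r \<le> n" "16 * k \<le> n" "2 * (16 * (k + 1) * k ^ k)\<^sup>2 \<le> n"
    and L: "1 \<le> L" "2 ^ (k - 1) * (k * L) \<le> n ^ (k - 1)"
  defines "w \<equiv> real n ^ (k + 1) * exp (- (p / 3 * (real n / 4) * real n ^ (r - 2) / (4 * real r) ^ r))"
  assumes w: "w \<le> 1"
  shows "measure_pmf.prob (random_hypergraph r n p)
      {E. \<not> (\<exists>Ms. acquaintance_strategy k {1..n} E Ms \<and> length Ms \<le> 56 * k * (k + 1)\<^sup>2 * L)}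
    \<le> 4 ^ n * exp (- (p / 3 * (real n / (16 * real k)) ^ 2 * real n ^ (r - 2) / (4 * real r) ^ r)) +
      (real n * w + real n ^ k * exp (- (p / 3 * real L * real n ^ (r - k) / (4 * real r) ^ r)))"
proof -
  define goal where
    "goal = (\<lambda>E. \<exists>Ms. acquaintance_strategy k {1..n} E Ms \<and> length Ms \<le> 56 * k * (k + 1)\<^sup>2 * L)"
  define m where "m = n div (8 * k)"
  define hole_free where "hole_free = (\<lambda>E. \<forall>X Y. X \<subseteq> {1..n} \<and> Y \<subseteq> {1..n} \<and> X \<inter> Y = {} \<and>
    card X = m \<and> card Y = m \<longrightarrow> (\<exists>x\<in>X. \<exists>y\<in>Y. adjacent E x y))"
  have r: "2 \<le> r" "1 \<le> r" using assms by simp_all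
  have mk: "8 * (k * m) \<le> n"
    using times_div_less_eq_dividend[of "8 * k" n] by (simp add: m_def mult_ac)
  have m_ge: "real n / (16 * real k) \<le> real m"
  proof -
    have "n < 8 * k * (m + 1)"
      using assms(1) dividend_less_times_div[of "8 * k" n] by (simp add: m_def)
    then have "2 * n \<le> 16 * k * m + 16 * k" by (simp add: algebra_simps)
    then have "n \<le> 16 * k * m" using n(2) by simp
    then have "real n \<le> 16 * real k * real m"
      by (metis of_nat_le_iff of_nat_mult of_nat_numeral)
    then show ?thesis using assms(1) by (simp add: pos_divide_le_eq mult_ac)
  qed
  have m_pos: "0 < m"
  proof -
    have "0 < real n / (16 * real k)" using n(2) assms(1) by simp
    then show ?thesis using m_ge by (metis less_le_trans of_nat_0_less_iff)
  qed

  define q where "q = p / 3"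
  define p' where "p' = (p - q) / (1 - q)"
  define q' where "q' = p' / 2"
  define q'' where "q'' = (p' - q') / (1 - q')"
  have q: "0 \<le> q" "q < 1" "q \<le> p" "q \<le> 1" using assms(3,4) by (auto simp: q_def)
  have p': "2 * p / 3 \<le> p'" "p' \<le> 1" "0 \<le> p'"
  proof -
    have "p - q \<le> p'" unfolding p'_def using q by (intro le_divide_one) auto
    then show "2 * p / 3 \<le> p'" by (simp add: q_def)
    then show "0 \<le> p'" using assms(3) by simp
    show "p' \<le> 1" unfolding p'_def using q assms(4) by (simp add: divide_le_eq)
  qed
  have q': "p / 3 \<le> q'" "q' < 1" "0 \<le> q'" "q' \<le> p'" "q' \<le> 1" using p' assms(3) by (auto simp: q'_def)
  have q'': "p / 3 \<le> q''" "q'' \<le> 1" "0 \<le> q''"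
  proof -
    have "p' - q' \<le> q''" unfolding q''_def using q' by (intro le_divide_one) auto
    then show "p / 3 \<le> q''" using p' by (simp add: q'_def)
    then show "0 \<le> q''" using assms(3) by simp
    show "q'' \<le> 1" unfolding q''_def using q' p' by (simp add: divide_le_eq)
  qed

  let ?a = "4 ^ n * exp (- (p / 3 * (real n / (16 * real k)) ^ 2 * real n ^ (r - 2) / (4 * real r) ^ r))"
  let ?c = "real n ^ k * exp (- (p / 3 * real L * real n ^ (r - k) / (4 * real r) ^ r))"
  have "measure_pmf.prob (random_hypergraph r n p) {E. \<not> goal E} \<le> ?a + (real n * w + ?c)"
  proof (rule sprinkling[where q=q and good=hole_free])
    show "0 \<le> q" "q < 1" "q \<le> p" "p \<le> 1" using q assms(4) by auto
    show "0 \<le> real n * w + ?c" by (simp add: w_def)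
    have "measure_pmf.prob (random_hypergraph r n q) {E. \<not> hole_free E} \<le>
        4 ^ n * exp (- (q * real m ^ 2 * real n ^ (r - 2) / (4 * real r) ^ r))"
      unfolding hole_free_def by (rule prob_hole[OF q(1,4) r(1) n(1)])
    also have "\<dots> \<le> ?a"
    proof -
      have "p / 3 * (real n / (16 * real k)) ^ 2 * real n ^ (r - 2) / (4 * real r) ^ r \<le>
          q * real m ^ 2 * real n ^ (r - 2) / (4 * real r) ^ r"
        unfolding q_def using assms(3) m_ge
        by (intro divide_right_mono mult_right_mono mult_left_mono power_mono) auto
      then show ?thesis by simp
    qed
    finally show "measure_pmf.prob (random_hypergraph r n q) {E. \<not> hole_free E} \<le> ?a" .
  next
    fix E1 assume E1: "E1 \<in> set_pmf (random_hypergraph r n q)" "hole_free E1"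
    obtain xs where xs: "distinct xs" "set xs \<subseteq> {1..n}" "successively (adjacent E1) xs"
        "card {1..n} \<le> length xs + 2 * m"
      using long_path_exists[of "{1..n}" m E1] m_pos E1(2) unfolding hole_free_def by auto
    define N where "N = length xs"
    define R where "R = {1..n} - set xs"
    have P: "(!) xs ` {..<N} = set xs" by (auto simp: N_def set_conv_nth)
    have path: "is_path E1 N ((!) xs)"
      using xs(1,3) by (auto simp: is_path_def N_def inj_on_def nth_eq_iff_index_eq successively_conv_nth)
    have cardP: "card (set xs) = N" using xs(1) by (simp add: N_def distinct_card)
    have nN: "n \<le> N + 2 * m" using xs(4) by (simp add: N_def)
    have cardR: "card R \<le> 2 * m"
      using nN xs(2) cardP by (simp add: R_def card_Diff_subset)
    have "2 * m \<le> k * m" using assms(1) by simp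
    then have "8 * m \<le> n" using mk by linarith
    then have N: "n \<le> 2 * N" "4 * N \<ge> 3 * n" using nN by linarith+
    have kR: "4 * (k * card R) \<le> n"
    proof -
      have "k * card R \<le> k * (2 * m)" using cardR by (rule mult_le_mono2)
      then show ?thesis using mk by linarith
    qed
    have kN: "k \<le> N" using n(2) N(1) by linarith
    have NN: "(16 * (k + 1) * k ^ k)\<^sup>2 \<le> N" using n(3) N(1) by linarith
    \<comment> \<open>The factor \<open>2 ^ (k - 1)\<close> in the hypothesis on \<open>L\<close>
      pays for \<open>N\<close> being possibly as small as \<open>n / 2\<close>.\<close>
    have LN: "k * L \<le> N ^ (k - 1)"
    proof -
      have "2 ^ (k - 1) * (k * L) \<le> (2 * N) ^ (k - 1)"
        using L(2) power_mono[OF N(1), of "k - 1"] by linarith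
      then show ?thesis by (simp add: power_mult_distrib)
    qed
    define linked where
      "linked = (\<lambda>E. \<forall>S\<subseteq>R. k * card S \<le> card {u\<in>set xs. \<exists>v\<in>S. adjacent E v u})"
    show "measure_pmf.prob (random_hypergraph r n ((p - q) / (1 - q))) {E'. \<not> goal (E1 \<union> E')} \<le> real n * w + ?c"
      unfolding p'_def[symmetric]
    \<comment> \<open>The path and \<open>R\<close> depend on \<open>E1\<close> alone, so the second
      split can treat them as given sets.\<close>
    proof (rule sprinkling[where q=q' and good=linked and goal="\<lambda>E'. goal (E1 \<union> E')"])
      show "0 \<le> q'" "q' < 1" "q' \<le> p'" "p' \<le> 1" using q' p' by auto
      show "0 \<le> ?c" by simp
      define w' where "w' = real n ^ (k + 1) * exp (- (q' * (real n / 4) * real n ^ (r - 2) / (4 * real r) ^ r))"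
      have "p / 3 * (real n / 4) * real n ^ (r - 2) / (4 * real r) ^ r \<le>
          q' * (real n / 4) * real n ^ (r - 2) / (4 * real r) ^ r"
        using q'(1) by (intro divide_right_mono mult_right_mono) auto
      then have w': "w' \<le> w"
        unfolding w'_def w_def by (intro mult_left_mono) auto
      have "measure_pmf.prob (random_hypergraph r n q') {E. \<not> linked E} \<le> real n * w'"
        unfolding linked_def w'_def
      proof (rule prob_small_neighbourhood[OF q'(3,5) r(1) n(1)])
        show "R \<subseteq> {1..n}" "set xs \<subseteq> {1..n}" "R \<inter> set xs = {}"
          using xs(2) by (auto simp: R_def)
        show "k * card R \<le> card (set xs)" unfolding cardP using kR N by linarith
        have "n + 4 * (k * card R) \<le> 4 * N" using kR N by linarith
        then have "real (n + 4 * (k * card R)) \<le> real (4 * N)" by (simp only: of_nat_le_iff)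
        then show "real n / 4 \<le> real (card (set xs)) - real (k * card R)" unfolding cardP by simp
        show "real n ^ (k + 1) * exp (- (q' * (real n / 4) * real n ^ (r - 2) / (4 * real r) ^ r)) \<le> 1"
          using w' w unfolding w'_def by linarith
      qed simp
      also have "\<dots> \<le> real n * w" using w' by (intro mult_left_mono) auto
      finally show "measure_pmf.prob (random_hypergraph r n q') {E. \<not> linked E} \<le> real n * w" .
    next
      fix E2 assume E2: "E2 \<in> set_pmf (random_hypergraph r n q')" "linked E2"
      have "finite R" by (simp add: R_def)
      then obtain f where f: "inj_on f (R \<times> {..<k})"
          "\<And>v i. v \<in> R \<Longrightarrow> i < k \<Longrightarrow> f (v, i) \<in> set xs \<and> adjacent E2 v (f (v, i))"
        using matchings_exist[of R "set xs" k E2] E2(2) unfolding linked_def by blast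
      have path': "is_path (E1 \<union> E2) N ((!) xs)"
        using path adjacent_mono[of E1 "E1 \<union> E2"] by (auto simp: is_path_def)
      have R': "R = {1..n} - (!) xs ` {..<N}" by (simp add: R_def P)
      have f': "f (v, i) \<in> (!) xs ` {..<N} \<and> adjacent (E1 \<union> E2) v (f (v, i))" if "v \<in> R" "i < k" for v i
        using f(2)[OF that] adjacent_mono[of E2 "E1 \<union> E2"] P by auto
      obtain Ms where Ms: "\<forall>M\<in>set Ms. swap_matching (E1 \<union> E2) M"
          "length Ms \<le> 56 * k * (k + 1)\<^sup>2 * L"
          "\<And>A. A \<subseteq> {1..n} \<Longrightarrow> card A = k \<Longrightarrow> L \<le> card (visits Ms A)"
        using hypergraph_schedule[OF finite_atLeastAtMost path' R' f(1) f' assms(1) kN NN L(1) LN] by metis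
      have "measure_pmf.prob (random_hypergraph r n q'') {E'. \<not> goal (E1 \<union> (E2 \<union> E'))} \<le>
          measure_pmf.prob (random_hypergraph r n q'') {E'. \<not> acquaintance_strategy k {1..n} (E1 \<union> E2 \<union> E') Ms}"
        using Ms(2) by (intro measure_pmf.finite_measure_mono) (auto simp: goal_def Un_assoc)
      also have "\<dots> \<le> real n ^ k * exp (- (q'' * real L * real n ^ (r - k) / (4 * real r) ^ r))"
      proof (rule prob_unacquainted[OF q''(3,2) assms(2) r(2) n(1) _ Ms(1,3)])
        show "E1 \<union> E2 \<subseteq> uniform_edges r n"
          using set_pmf_random_hypergraph[OF E1(1)] set_pmf_random_hypergraph[OF E2(1)] by simp
      qed
      also have "\<dots> \<le> ?c"
      proof -
        have "p / 3 * real L * real n ^ (r - k) / (4 * real r) ^ r \<le> q'' * real L * real n ^ (r - k) / (4 * real r) ^ r"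
          using q''(1) by (intro divide_right_mono mult_right_mono) auto
        then show ?thesis by (intro mult_left_mono) auto
      qed
      finally show "measure_pmf.prob (random_hypergraph r n ((p' - q') / (1 - q'))) {E'. \<not> goal (E1 \<union> (E2 \<union> E'))} \<le> ?c"
        unfolding q''_def .
    qed
  qed
  then show ?thesis by (simp add: goal_def)
qed

section \<open>Choice of the constants and the limit\<close>

lemma power_exp_ln: "0 < n \<Longrightarrow> real n ^ j * exp (- (real i * ln (real n))) = real n ^ j / real n ^ i"
  by (simp add: exp_minus exp_of_nat_mult divide_inverse)

theorem theorem1:
  fixes r k :: nat and \<omega> p :: "nat \<Rightarrow> real"
  assumes "r \<ge> 2" and "2 \<le> k" and "k \<le> r"
    and "filterlim \<omega> at_top sequentially"
    and "\<And>n. n \<ge> 1 \<Longrightarrow> p n = \<omega> n * ln (real n) / real n ^ (r - 1)"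
    and "\<And>n. n \<ge> 1 \<Longrightarrow> p n \<in> {0..1}"
  shows "\<exists>C::real. C > 0 \<and>
    (\<lambda>n. measure_pmf.prob (random_hypergraph r n (p n))
       {E. ereal_of_enat (acquaintance_time k {1..n} E)
             \<le> ereal (C * max (ln (real n) / (p n * real n ^ (r - k))) 1)})
      \<longlonglongrightarrow> 1"
proof -
  \<comment> \<open>\<open>c\<close> is the loss from counting edges. \<open>C0\<close> makes the
    acquaintance exponent at least \<open>(k + 1) * ln n\<close>, and \<open>C\<close> adds the
    length factor \<open>K\<close> and the rounding of \<open>L\<close>.\<close>
  define c where "c = (4 * real r) ^ r"
  define C0 where "C0 = 3 * (real k + 1) * c"
  define K where "K = 56 * k * (k + 1)\<^sup>2"
  define C where "C = real K * (C0 + 1)"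
  \<comment> \<open>A sum of nonnegative lower bounds on \<open>\<omega>\<close>, so that each of
    them follows from \<open>W \<le> \<omega> n\<close>: for the absence of holes, for the
    matchings, and for \<open>L\<close> to stay within the range of the path schedule.\<close>
  define W where "W = 1536 * real k ^ 2 * c + 12 * (real k + 3) * c + 2 ^ k * real k * C0 + 1"
  define n0 where "n0 = 2 * r + 16 * k + 2 * (16 * (k + 1) * k ^ k)\<^sup>2 + k * 2 ^ k + 4"
  have c: "0 < c" using assms(1) by (simp add: c_def)
  have C0: "0 < C0" using c by (simp add: C0_def)
  have "0 < K" using assms(2) by (simp add: K_def)
  then have C: "0 < C" using C0 by (simp add: C_def)
  let ?P = "\<lambda>n. measure_pmf.prob (random_hypergraph r n (p n))
       {E. ereal_of_enat (acquaintance_time k {1..n} E)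
             \<le> ereal (C * max (ln (real n) / (p n * real n ^ (r - k))) 1)}"
  have main: "1 - 3 / real n \<le> ?P n" if n: "n0 \<le> n" and \<omega>: "W \<le> \<omega> n" for n
  proof -
    have nb: "2 * r \<le> n" "16 * k \<le> n" "2 * (16 * (k + 1) * k ^ k)\<^sup>2 \<le> n" "k * 2 ^ k \<le> n" "4 \<le> n"
      using n by (auto simp: n0_def)
    have pos: "0 < real n" "1 \<le> real n" using nb(5) by auto
    have ln1: "ln 4 \<le> ln (real n)" using nb(5) by simp
    have "0 < ln (4 :: real)" by simp
    with ln1 have ln: "0 < ln (real n)" by linarith
    have terms: "0 \<le> 1536 * real k ^ 2 * c" "0 \<le> 12 * (real k + 3) * c" "0 \<le> 2 ^ k * real k * C0"
      using c C0 by simp_all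
    have \<omega>s: "1536 * real k ^ 2 * c \<le> \<omega> n" "12 * (real k + 3) * c \<le> \<omega> n" "2 ^ k * real k * C0 \<le> \<omega> n" "1 \<le> \<omega> n"
      using \<omega> terms unfolding W_def by linarith+
    have pn: "p n * real n ^ (r - 1) = \<omega> n * ln (real n)"
      using assms(5)[of n] pos nb(5) by simp
    have p01: "0 \<le> p n" "p n \<le> 1" using assms(6)[of n] nb(5) by auto
    have "0 < p n * real n ^ (r - 1)" unfolding pn using ln \<omega>s(4) by simp
    then have p_pos: "0 < p n" using pos by (simp add: zero_less_mult_iff)
    have pw1: "real n ^ (r - 1) = real n ^ (r - k) * real n ^ (k - 1)"
      using assms(2,3) by (simp flip: power_add)
    have pw2: "real n ^ (r - 1) = real n * real n ^ (r - 2)"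
      using assms(1) by (simp flip: power_Suc add: numeral_2_eq_2 Suc_diff_Suc)
    define t where "t = ln (real n) / (p n * real n ^ (r - k))"
    have t_pos: "0 < t" using ln p_pos pos by (simp add: t_def)
    \<comment> \<open>Here \<open>t\<close> falls short of \<open>n ^ (k - 1)\<close> by the factor
      \<open>\<omega> n\<close>, which is what keeps \<open>L\<close> small enough for the path
      schedule.\<close>
    have t: "t * \<omega> n = real n ^ (k - 1)"
    proof -
      have "t * \<omega> n = p n * real n ^ (r - 1) / (p n * real n ^ (r - k))"
        unfolding t_def pn by simp
      also have "\<dots> = real n ^ (k - 1)"
        unfolding pw1 using p_pos pos by simp
      finally show ?thesis .
    qed
    define L where "L = nat \<lceil>C0 * t\<rceil>"
    have L: "C0 * t \<le> real L" "real L \<le> C0 * t + 1" "1 \<le> L"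
    proof -
      have "0 < C0 * t" using C0 t_pos by simp
      then show "C0 * t \<le> real L" "real L \<le> C0 * t + 1" "1 \<le> L"
        unfolding L_def by linarith+
    qed
    have LB: "2 ^ (k - 1) * (k * L) \<le> n ^ (k - 1)"
    proof -
      \<comment> \<open>Half of \<open>n ^ (k - 1)\<close> is reserved for the main term
        \<open>C0 * t\<close>, the other half for the \<open>+ 1\<close> from rounding up.\<close>
      have two: "(2::real) ^ k = 2 * 2 ^ (k - 1)"
        using assms(2) by (simp flip: power_Suc)
      have "(2 ^ k * real k * C0) * t \<le> \<omega> n * t"
        using \<omega>s(3) t_pos by (intro mult_right_mono) auto
      then have 1: "2 * (2 ^ (k - 1) * real k * (C0 * t)) \<le> real n ^ (k - 1)"
        using t unfolding two by (simp add: mult_ac)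
      have "real (k * 2 ^ k) \<le> real n" using nb(4) by (simp only: of_nat_le_iff)
      also have "real n = real n ^ 1" by simp
      also have "\<dots> \<le> real n ^ (k - 1)"
        using pos assms(2) by (intro power_increasing) auto
      finally have 2: "2 * (2 ^ (k - 1) * real k) \<le> real n ^ (k - 1)"
        unfolding of_nat_mult of_nat_power of_nat_numeral two by (simp add: mult_ac)
      have "2 ^ (k - 1) * (real k * real L) \<le> 2 ^ (k - 1) * (real k * (C0 * t + 1))"
        using L(2) by (intro mult_left_mono) auto
      also have "\<dots> = 2 ^ (k - 1) * real k * (C0 * t) + 2 ^ (k - 1) * real k"
        by (simp add: algebra_simps)
      also have "\<dots> \<le> real n ^ (k - 1)" using 1 2 by linarith
      finally have "real (2 ^ (k - 1) * (k * L)) \<le> real (n ^ (k - 1))" by simp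
      then show ?thesis by (simp only: of_nat_le_iff)
    qed
    define x1 where "x1 = p n / 3 * (real n / (16 * real k)) ^ 2 * real n ^ (r - 2) / (4 * real r) ^ r"
    define x2 where "x2 = p n / 3 * (real n / 4) * real n ^ (r - 2) / (4 * real r) ^ r"
    define x3 where "x3 = p n / 3 * real L * real n ^ (r - k) / (4 * real r) ^ r"
    define w where "w = real n ^ (k + 1) * exp (- x2)"
    have x1: "2 * (real n * ln (real n)) \<le> x1"
    proof -
      have "x1 = (p n * real n ^ (r - 1)) * real n / (768 * real k ^ 2 * c)"
        unfolding x1_def c_def pw2 by (simp add: power2_eq_square field_simps)
      also have "\<dots> = \<omega> n * (real n * ln (real n)) / (768 * real k ^ 2 * c)"
        unfolding pn by simp
      finally have eq: "x1 = \<omega> n * (real n * ln (real n)) / (768 * real k ^ 2 * c)" .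
      have "0 < 768 * real k ^ 2 * c" using c assms(2) by simp
      moreover have "1536 * real k ^ 2 * c * (real n * ln (real n)) \<le> \<omega> n * (real n * ln (real n))"
        using \<omega>s(1) ln pos by (intro mult_right_mono) auto
      ultimately show ?thesis unfolding eq by (subst pos_le_divide_eq) (simp_all add: mult_ac)
    qed
    have x2: "real (k + 3) * ln (real n) \<le> x2"
    proof -
      have "x2 = (p n * real n ^ (r - 1)) / (12 * c)"
        unfolding x2_def c_def pw2 by simp
      also have "\<dots> = \<omega> n * ln (real n) / (12 * c)" unfolding pn ..
      finally have eq: "x2 = \<omega> n * ln (real n) / (12 * c)" .
      have "12 * (real k + 3) * c * ln (real n) \<le> \<omega> n * ln (real n)"
        using \<omega>s(2) ln by (intro mult_right_mono) auto
      then show ?thesis unfolding eq using c by (subst pos_le_divide_eq) (simp_all add: mult_ac)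
    qed
    have x3: "real (k + 1) * ln (real n) \<le> x3"
    proof -
      have "real (k + 1) * ln (real n) = p n / 3 * (C0 * t) * real n ^ (r - k) / c"
        unfolding C0_def t_def using p_pos pos c by simp
      also have "\<dots> \<le> x3"
        unfolding x3_def c_def[symmetric] using p01 c L(1)
        by (intro divide_right_mono mult_right_mono mult_left_mono) auto
      finally show ?thesis .
    qed
    \<comment> \<open>Of the exponent \<open>2 * n * ln n\<close>, one half cancels
      \<open>4 ^ n\<close> because \<open>n \<ge> 4\<close>, and the other half leaves at most
      \<open>1 / n\<close>.\<close>
    have b1: "4 ^ n * exp (- x1) \<le> 1 / real n"
    proof -
      have "4 ^ n * exp (- x1) = exp (real n * ln 4 - x1)"
        by (simp add: exp_diff exp_minus exp_of_nat_mult divide_inverse)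
      also have "\<dots> \<le> exp (- ln (real n))"
      proof -
        have "real n * ln 4 \<le> real n * ln (real n)" using ln1 pos by (intro mult_left_mono) auto
        moreover have "1 * ln (real n) \<le> real n * ln (real n)" using ln pos by (intro mult_right_mono) auto
        ultimately show ?thesis using x1 by simp
      qed
      also have "\<dots> = 1 / real n" using pos by (simp add: exp_minus divide_inverse)
      finally show ?thesis .
    qed
    have w: "real n * w \<le> 1 / real n" "w \<le> 1"
    proof -
      have "w \<le> real n ^ (k + 1) * exp (- (real (k + 3) * ln (real n)))"
        unfolding w_def using x2 by (intro mult_left_mono) auto
      also have "\<dots> = 1 / real n ^ 2"
        using pos by (subst power_exp_ln) (auto simp: power_add field_simps eval_nat_numeral)
      finally have *: "w \<le> 1 / real n ^ 2" .
      then have "real n * w \<le> real n * (1 / real n ^ 2)"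
        by (intro mult_left_mono) auto
      then show "real n * w \<le> 1 / real n" using pos by (simp add: power2_eq_square)
      have "1 / real n ^ 2 \<le> 1" using pos by simp
      then show "w \<le> 1" using * by linarith
    qed
    have b3: "real n ^ k * exp (- x3) \<le> 1 / real n"
    proof -
      have "real n ^ k * exp (- x3) \<le> real n ^ k * exp (- (real (k + 1) * ln (real n)))"
        using x3 by (intro mult_left_mono) auto
      also have "\<dots> = 1 / real n"
        using pos by (subst power_exp_ln) auto
      finally show ?thesis .
    qed
    let ?bad = "{E. \<not> (\<exists>Ms. acquaintance_strategy k {1..n} E Ms \<and> length Ms \<le> 56 * k * (k + 1)\<^sup>2 * L)}"
    have "measure_pmf.prob (random_hypergraph r n (p n)) ?bad \<le>
        4 ^ n * exp (- x1) + (real n * w + real n ^ k * exp (- x3))"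
      using prob_slow_le[OF assms(2,3) p01 nb(1-3) L(3) LB] w(2)
      unfolding w_def x1_def x2_def x3_def by blast
    also have "\<dots> \<le> 3 / real n" using b1 w(1) b3 by simp
    finally have bad: "measure_pmf.prob (random_hypergraph r n (p n)) ?bad \<le> 3 / real n" .
    have fast: "ereal_of_enat (acquaintance_time k {1..n} E) \<le> ereal (C * max t 1)"
      if Ms: "acquaintance_strategy k {1..n} E Ms" "length Ms \<le> 56 * k * (k + 1)\<^sup>2 * L" for E Ms
    proof -
      have "acquaintance_time k {1..n} E \<le> enat (length Ms)"
        unfolding acquaintance_time_def using Ms(1) by (intro INF_lower) simp
      then have "ereal_of_enat (acquaintance_time k {1..n} E) \<le> ereal_of_enat (enat (length Ms))"
        by (simp only: ereal_of_enat_le_iff)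
      also have "\<dots> = ereal (real (length Ms))" by simp
      also have "\<dots> \<le> ereal (C * max t 1)"
      proof -
        have "real (length Ms) \<le> real (K * L)"
          using Ms(2) by (simp only: K_def of_nat_le_iff)
        also have "\<dots> \<le> real K * (C0 * t + 1)"
          unfolding of_nat_mult using L(2) by (intro mult_left_mono) auto
        \<comment> \<open>The maximum with 1 covers the rounding term, which explains the summand 1
          in \<open>C0 + 1\<close>.\<close>
        also have "\<dots> \<le> real K * (C0 * max t 1 + max t 1)"
          using C0 by (intro mult_left_mono add_mono) auto
        also have "\<dots> = C * max t 1" by (simp add: C_def algebra_simps)
        finally show ?thesis by simp
      qed
      finally show ?thesis .
    qed
    have "1 - measure_pmf.prob (random_hypergraph r n (p n)) ?bad =
        measure_pmf.prob (random_hypergraph r n (p n)) (- ?bad)"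
      using measure_pmf.prob_compl[of ?bad "random_hypergraph r n (p n)"] by (simp add: Compl_eq_Diff_UNIV)
    also have "\<dots> \<le> ?P n"
      using fast unfolding t_def by (intro measure_pmf.finite_measure_mono) auto
    finally show ?thesis using bad by linarith
  qed
  have "\<forall>\<^sub>F n in sequentially. 1 - 3 / real n \<le> ?P n"
    using eventually_ge_at_top[of n0] filterlim_at_top[THEN iffD1, OF assms(4), rule_format, of W]
    by eventually_elim (rule main)
  moreover have "\<forall>\<^sub>F n in sequentially. ?P n \<le> 1"
    by (intro always_eventually allI measure_pmf.prob_le_1)
  moreover have "(\<lambda>n. 1 - 3 / real n) \<longlonglongrightarrow> 1 - 0"
    by (intro tendsto_intros lim_const_over_n)
  ultimately have "?P \<longlonglongrightarrow> 1"
    by (intro tendsto_sandwich[of "\<lambda>n. 1 - 3 / real n" ?P sequentially "\<lambda>_. 1"]) auto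
  then show ?thesis using C by blast
qed

end
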